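(* Let $p\ge1$ with $p\ne d/2$, and suppose that there exist $a>p$ and $A>0$ such that the distributions $\mathbb P_1,\dots,\mathbb P_K\in\mathcal P(\Xi)$ are all $(a,A)$-light tailed. Let $\mathbb P$ be a distribution on $\Xi$. If $W_p(\mathbb P_k,\mathbb P)\le r_k$ and if $\varepsilon_k\ge r_k+\varepsilon(\beta_k,N_k)$ for some $\beta_k\in(0,1]$ and for all $k\in[K]$, then $$\mathbb P_{[K]}\Big(\mathbb P\in\bigcap_{k=1}^K\mathbb B^p_{\varepsilon_k}(\widehat{\mathbb P}_k)\Big)\ge1-\sum_{k=1}^K\beta_k.$$
   Context: $\Xi\subseteq\mathbb{R}^d$ is closed and convex, $[K]=\{1,\dots,K\}$, and $W_p$ is the $p$-Wasserstein distance induced by a metric on $\Xi$. $\mathbb B^p_r(\mathbb P)=\{\mathbb Q\in\mathcal P(\Xi): W_p(\mathbb Q,\mathbb P)\le r\}$. A distribution $\mathbb P$ is $(a,A)$-light tailed if $\mathbb E_{\mathbb P}[\exp(\|\xi\|^a)]\le A$. For each $k$, $\widehat{\mathbb P}_k=\frac1{N_k}\sum_{j=1}^{N_k}\delta_{\widehat\xi_{k,j}}$ is the empirical distribution of $N_k$ independent samples from $\mathbb P_k$; $\mathbb P_{[K]}=\bigotimes_{k=1}^K\mathbb P_k^{N_k}$ is the joint distribution of all samples. The constants $c_1,c_2>0$, depending only on $a$, $A$ and $d$, are such that the following concentration inequality holds: for every $k\in[K]$, $\mathbb P_k^{N_k}[\mathbb P_k\in\mathbb B^p_{\varepsilon}(\widehat{\mathbb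 P}_k)]\ge1-\beta(\varepsilon,N_k)$ for all $\varepsilon\in\mathbb{R}_+$ and $N_k\in\mathbb N$, where $$\beta(\varepsilon,N)=\begin{cases}c_1\exp(-c_2N\varepsilon^{\max\{d/p,2\}})&\text{if }\varepsilon\le1,\\ c_1\exp(-c_2N\varepsilon^{a/p})&\text{if }\varepsilon>1.\end{cases}$$ (The paper takes this inequality from earlier work; it is a given here.) Moreover, obtained by solving $\beta(\varepsilon,N)=\beta$ for $\varepsilon$, $$\varepsilon(\beta,N)=\begin{cases}\left(\log(c_1/\beta)/(c_2N)\right)^{\min\{p/d,1/2\}}&\text{if }N\ge\log(c_1/\beta)/c_2,\\ \left(\log(c_1/\beta)/(c_2N)\right)^{p/a}&\text{if }N<\log(c_1/\beta)/c_2.\end{cases}$$ *)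

theory Defs
  imports "HOL-Probability.Probability"
begin

definition distributions_on :: "'a::topological_space set \<Rightarrow> 'a measure set" where
  "distributions_on \<Xi> = {P. sets P = sets (restrict_space borel \<Xi>) \<and> prob_space P}"

definition light_tailed :: "real \<Rightarrow> real \<Rightarrow> 'a::real_normed_vector measure \<Rightarrow> bool" where
  "light_tailed a A P \<longleftrightarrow> (\<integral>\<^sup>+ x. ennreal (exp (norm x powr a)) \<partial>P) \<le> ennreal A"

definition couplings :: "'a measure \<Rightarrow> 'b measure \<Rightarrow> ('a \<times> 'b) measure set" where
  "couplings P Q =
     {\<gamma>. sets \<gamma> = sets (P \<Otimes>\<^sub>M Q) \<and> distr \<gamma> P fst = P \<and> distr \<gamma> Q snd = Q}"

(* Extended-real valued: the distance is infinite if no coupling has finite p-th order cost. *)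
definition wasserstein ::
    "('a \<Rightarrow> 'a \<Rightarrow> real) \<Rightarrow> real \<Rightarrow> 'a measure \<Rightarrow> 'a measure \<Rightarrow> ereal" where
  "wasserstein \<delta> p P Q =
     (let c = (INF \<gamma> \<in> couplings P Q. \<integral>\<^sup>+ (x, y). ennreal (\<delta> x y powr p) \<partial>\<gamma>)
      in if c = \<infinity> then \<infinity> else ereal (enn2real c powr (1 / p)))"

definition wasserstein_ball ::
    "'a::topological_space set \<Rightarrow> ('a \<Rightarrow> 'a \<Rightarrow> real) \<Rightarrow> real \<Rightarrow> real \<Rightarrow> 'a measure \<Rightarrow> 'a measure set"
  where
  "wasserstein_ball \<Xi> \<delta> p r P = {Q \<in> distributions_on \<Xi>. wasserstein \<delta> p Q P \<le> ereal r}"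

definition empirical :: "'a::topological_space set \<Rightarrow> nat \<Rightarrow> (nat \<Rightarrow> 'a) \<Rightarrow> 'a measure" where
  "empirical \<Xi> n x =
     (let S = restrict_space borel \<Xi>
      in measure_of \<Xi> (sets S)
           (\<lambda>B. (\<Sum>j = 1..n. emeasure (return S (x j)) B) / of_nat n))"

lemma space_empirical: "space (empirical \<Xi> n x) = \<Xi>"
  and sets_empirical: "sets (empirical \<Xi> n x) = sets (restrict_space borel \<Xi>)"
proof -
  have "sigma_sets \<Xi> (sets (restrict_space borel \<Xi>)) = sets (restrict_space borel \<Xi>)"
    using sets.sigma_sets_eq[of "restrict_space borel \<Xi>"] by (simp add: space_restrict_space)
  moreover have "sets (restrict_space borel \<Xi>) \<subseteq> Pow \<Xi>"
    using sets.space_closed[of "restrict_space borel \<Xi>"] by (simp add: space_restrict_space)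
  ultimately show "space (empirical \<Xi> n x) = \<Xi>"
    "sets (empirical \<Xi> n x) = sets (restrict_space borel \<Xi>)"
    by (simp_all add: empirical_def Let_def)
qed

lemma emeasure_empirical:
  assumes "B \<in> sets (restrict_space borel \<Xi>)"
  shows "emeasure (empirical \<Xi> n x) B = (\<Sum>j = 1..n. indicator B (x j)) / of_nat n"
proof -
  let ?S = "restrict_space borel \<Xi>"
  let ?\<mu> = "\<lambda>B. (\<Sum>j = 1..n. emeasure (return ?S (x j)) B) / of_nat n"
  have "countably_additive (sets ?S) ?\<mu>"
  proof (rule countably_additiveI)
    fix A :: "nat \<Rightarrow> 'a set"
    assume A: "range A \<subseteq> sets ?S" "disjoint_family A"
    have "(\<Sum>i. ?\<mu> (A i)) = (\<Sum>i. \<Sum>j = 1..n. emeasure (return ?S (x j)) (A i)) / of_nat n"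
      by (simp add: divide_ennreal_def)
    also have "\<dots> = (\<Sum>j = 1..n. \<Sum>i. emeasure (return ?S (x j)) (A i)) / of_nat n"
      by (subst suminf_sum) auto
    also have "\<dots> = ?\<mu> (\<Union>i. A i)"
    proof -
      have "(\<Sum>i. emeasure (return ?S (x j)) (A i)) = emeasure (return ?S (x j)) (\<Union>i. A i)" for j
        by (rule suminf_emeasure) (use A in auto)
      then show ?thesis
        by (simp only:)
    qed
    finally show "(\<Sum>i. ?\<mu> (A i)) = ?\<mu> (\<Union>i. A i)" .
  qed
  moreover have "positive (sets ?S) ?\<mu>"
    by (simp add: positive_def)
  moreover have "sigma_algebra \<Xi> (sets ?S)"
    using sets.sigma_algebra_axioms[of ?S] by (simp add: space_restrict_space)
  ultimately have "emeasure (empirical \<Xi> n x) B = ?\<mu> B"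
    using assms by (simp add: empirical_def Let_def emeasure_measure_of_sigma)
  then show ?thesis
    using assms by simp
qed

definition confidence_level ::
    "real \<Rightarrow> real \<Rightarrow> real \<Rightarrow> real \<Rightarrow> real \<Rightarrow> real \<Rightarrow> nat \<Rightarrow> real" where
  "confidence_level d p a c\<^sub>1 c\<^sub>2 \<epsilon> n =
     (if \<epsilon> \<le> 1 then c\<^sub>1 * exp (- c\<^sub>2 * real n * \<epsilon> powr max (d / p) 2)
      else c\<^sub>1 * exp (- c\<^sub>2 * real n * \<epsilon> powr (a / p)))"

definition confidence_radius ::
    "real \<Rightarrow> real \<Rightarrow> real \<Rightarrow> real \<Rightarrow> real \<Rightarrow> real \<Rightarrow> nat \<Rightarrow> real" where
  "confidence_radius d p a c\<^sub>1 c\<^sub>2 \<beta> n =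
     (if real n \<ge> ln (c\<^sub>1 / \<beta>) / c\<^sub>2
      then (ln (c\<^sub>1 / \<beta>) / (c\<^sub>2 * real n)) powr min (p / d) (1 / 2)
      else (ln (c\<^sub>1 / \<beta>) / (c\<^sub>2 * real n)) powr (p / a))"

end

theory Submission
  imports Defs
begin

text \<open>
  By the triangle inequality, \<open>P\<^sub>k\<close> in the ball of radius \<open>\<epsilon>(\<beta>\<^sub>k, N\<^sub>k)\<close> around the empirical distribution
  forces \<open>P\<close> into the ball of radius \<open>\<epsilon>\<^sub>k\<close>; concentration bounds the probability of the former event
  below by \<open>1 - \<beta>\<^sub>k\<close>, and independence across \<open>k\<close> gives \<open>\<Prod>\<^sub>k (1 - \<beta>\<^sub>k) \<ge> 1 - \<Sum>\<^sub>k \<beta>\<^sub>k\<close>.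
  A non-measurable set has measure \<open>0\<close> here, so the event for \<open>P\<close> must be shown to be measurable, although
  the Wasserstein distance is an infimum over an uncountable family and the metric need not be continuous.
  As the empirical distribution has finitely many atoms, a coupling with it amounts to \<open>n\<close> densities
  with respect to \<open>P\<close>, and the transport cost is \<open>L\<^sup>1(P)\<close>-Lipschitz in the cost functions
  \<open>y \<mapsto> \<delta>(y, x\<^sub>j)\<^sup>p\<close>. These range over a separable subset of \<open>L\<^sup>1(P)\<close>, so the infimum reduces to
  a countable one. The same densities glue couplings in the triangle inequality, with no need for
  disintegration.
\<close>

subsection \<open>Transport to finitely many atoms\<close>

text \<open>Without the root and with an arbitrary cost \<open>c\<close>; for
  \<open>c y z = \<delta> y z powr p\<close> this is the infimum inside
  \<open>wasserstein\<close>.\<close>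

definition transport_cost :: "('a \<Rightarrow> 'b \<Rightarrow> ennreal) \<Rightarrow> 'a measure \<Rightarrow> 'b measure \<Rightarrow> ennreal" where
  "transport_cost c P Q = (INF \<gamma> \<in> couplings P Q. \<integral>\<^sup>+ (x, y). c x y \<partial>\<gamma>)"

text \<open>A coupling of \<open>P\<close> with the uniform distribution on \<open>x\<^sub>1, \<dots>, x\<^sub>n\<close> splits \<open>P\<close> into \<open>n\<close> pieces of
  mass \<open>1/n\<close>; the piece transported to \<open>x\<^sub>j\<close> has density \<open>f j\<close> with respect to \<open>P\<close>.\<close>

definition transport_plans :: "nat \<Rightarrow> 'a measure \<Rightarrow> (nat \<Rightarrow> 'a \<Rightarrow> ennreal) set" where
  "transport_plans n P =
     {f. (\<forall>j\<in>{1..n}. f j \<in> borel_measurable P \<and> (\<integral>\<^sup>+ y. f j y \<partial>P) = 1 / of_nat n) \<and>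
         (AE y in P. (\<Sum>j = 1..n. f j y) = 1)}"

text \<open>\<open>g j\<close> is the cost of moving mass to the atom with index \<open>j\<close>.
  Leaving it arbitrary lets the true costs be replaced by approximants that come from no
  atom.\<close>

definition plan_cost :: "nat \<Rightarrow> 'a measure \<Rightarrow> (nat \<Rightarrow> 'a \<Rightarrow> ennreal) \<Rightarrow> ennreal" where
  "plan_cost n P g = (INF f \<in> transport_plans n P. \<Sum>j = 1..n. \<integral>\<^sup>+ y. f j y * g j y \<partial>P)"

lemma
  assumes "f \<in> transport_plans n P"
  shows transport_plans_measurable: "j \<in> {1..n} \<Longrightarrow> f j \<in> borel_measurable P"
    and transport_plans_integral: "j \<in> {1..n} \<Longrightarrow> (\<integral>\<^sup>+ y. f j y \<partial>P) = 1 / of_nat n"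
    and transport_plans_sum: "AE y in P. (\<Sum>j = 1..n. f j y) = 1"
  using assms by (auto simp: transport_plans_def)

lemma transport_plans_le_1:
  assumes "f \<in> transport_plans n P" "j \<in> {1..n}"
  shows "AE y in P. f j y \<le> 1"
  using transport_plans_sum[OF assms(1)]
proof eventually_elim
  case (elim y)
  have "f j y \<le> (\<Sum>j = 1..n. f j y)"
    using assms(2) by (intro member_le_sum) auto
  with elim show ?case by simp
qed

text \<open>The densities add up to 1 almost everywhere, so a function that does not depend on the
  atom cannot see the splitting.\<close>

lemma nn_integral_transport_plans_mult:
  assumes f: "f \<in> transport_plans n P" and [measurable]: "h \<in> borel_measurable P"
  shows "(\<Sum>j = 1..n. \<integral>\<^sup>+ y. f j y * h y \<partial>P) = (\<integral>\<^sup>+ y. h y \<partial>P)"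
proof -
  note [measurable] = transport_plans_measurable[OF f]
  have "(\<Sum>j = 1..n. \<integral>\<^sup>+ y. f j y * h y \<partial>P) = (\<integral>\<^sup>+ y. (\<Sum>j = 1..n. f j y * h y) \<partial>P)"
    by (subst nn_integral_sum) auto
  also have "\<dots> = (\<integral>\<^sup>+ y. h y \<partial>P)"
    using transport_plans_sum[OF f]
    by (intro nn_integral_cong_AE) (auto simp flip: sum_distrib_right)
  finally show ?thesis .
qed

section \<open>Integration against the empirical distribution\<close>

lemma sum_one_div_mult_ennreal:
  "(\<Sum>j = 1..n. 1 / of_nat n * b j) = (\<Sum>j = 1..n. b j) / (of_nat n :: ennreal)"
  by (simp add: divide_ennreal_def sum_distrib_right[symmetric] mult.commute)

lemma nn_integral_empirical:
  assumes x: "\<And>j. j \<in> {1..n} \<Longrightarrow> x j \<in> \<Xi>"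
    and h: "h \<in> borel_measurable (restrict_space borel \<Xi>)"
  shows "(\<integral>\<^sup>+ z. h z \<partial>empirical \<Xi> n x) = (\<Sum>j = 1..n. h (x j)) / of_nat n"
proof -
  let ?S = "restrict_space borel \<Xi>"
  let ?C = "point_measure {1..n} (\<lambda>_. 1 / of_nat n :: ennreal)"
  have mx: "x \<in> measurable ?C ?S"
    using x by (auto simp: space_restrict_space measurable_def sets_point_measure space_point_measure)
  \<comment> \<open>Putting the weight \<open>1 / n\<close> on indices rather than on points takes
    care of repeated samples.\<close>
  have "empirical \<Xi> n x = distr ?C ?S x"
  proof (rule measure_eqI)
    fix B assume "B \<in> sets (empirical \<Xi> n x)"
    then have B: "B \<in> sets ?S" by (simp add: sets_empirical)
    have "emeasure (distr ?C ?S x) B = (\<integral>\<^sup>+ z. indicator B z \<partial>distr ?C ?S x)"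
      using B by simp
    also have "\<dots> = (\<integral>\<^sup>+ j. indicator B (x j) \<partial>?C)"
      using mx B by (subst nn_integral_distr) auto
    also have "\<dots> = (\<Sum>j = 1..n. indicator B (x j)) / of_nat n"
      by (subst nn_integral_point_measure_finite) (auto simp: divide_ennreal_def sum_distrib_left mult.commute)
    finally show "emeasure (empirical \<Xi> n x) B = emeasure (distr ?C ?S x) B"
      using B by (simp add: emeasure_empirical)
  qed (simp add: sets_empirical)
  then have "(\<integral>\<^sup>+ z. h z \<partial>empirical \<Xi> n x) = (\<integral>\<^sup>+ j. h (x j) \<partial>?C)"
    using mx h by (simp add: nn_integral_distr)
  also have "\<dots> = (\<Sum>j = 1..n. h (x j)) / of_nat n"
    by (subst nn_integral_point_measure_finite) (auto simp: divide_ennreal_def sum_distrib_left mult.commute)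
  finally show ?thesis .
qed

lemma couplingsD:
  assumes "\<gamma> \<in> couplings P Q"
  shows "sets \<gamma> = sets (P \<Otimes>\<^sub>M Q)" "distr \<gamma> P fst = P" "distr \<gamma> Q snd = Q"
    "fst \<in> measurable \<gamma> P" "snd \<in> measurable \<gamma> Q"
proof -
  show *: "sets \<gamma> = sets (P \<Otimes>\<^sub>M Q)" "distr \<gamma> P fst = P" "distr \<gamma> Q snd = Q"
    using assms by (auto simp: couplings_def)
  show "fst \<in> measurable \<gamma> P" "snd \<in> measurable \<gamma> Q"
    by (simp_all add: measurable_cong_sets[OF *(1) refl])
qed

section \<open>Couplings with a uniform distribution on finitely many points\<close>

text \<open>Collects all that the transport argument uses of the empirical distribution. The points
  may coincide; the integral formula counts them with multiplicity.\<close>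

locale uniform_on_points =
  fixes E :: "'a measure" and n :: nat and x :: "nat \<Rightarrow> 'a"
  assumes n: "n \<ge> 1"
    and x: "j \<in> {1..n} \<Longrightarrow> x j \<in> space E"
    and sing: "j \<in> {1..n} \<Longrightarrow> {x j} \<in> sets E"
    and integral_E: "h \<in> borel_measurable E \<Longrightarrow> (\<integral>\<^sup>+ z. h z \<partial>E) = (\<Sum>j = 1..n. h (x j)) / of_nat n"

text \<open>Singletons are measurable because points are closed in a
  \<open>t1_space\<close>.\<close>

lemma uniform_on_points_empirical:
  fixes \<Xi> :: "'a::t1_space set"
  assumes "n \<ge> 1" and x: "\<And>j. j \<in> {1..n} \<Longrightarrow> x j \<in> \<Xi>"
  shows "uniform_on_points (empirical \<Xi> n x) n x"
proof
  fix j assume j: "j \<in> {1..n}"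
  show "x j \<in> space (empirical \<Xi> n x)"
    using x[OF j] by (simp add: space_empirical)
  show "{x j} \<in> sets (empirical \<Xi> n x)"
    using x[OF j] by (auto simp: sets_empirical sets_restrict_space intro!: image_eqI[of _ _ "{x j}"])
next
  fix h :: "'a \<Rightarrow> ennreal" assume "h \<in> borel_measurable (empirical \<Xi> n x)"
  then have "h \<in> borel_measurable (restrict_space borel \<Xi>)"
    by (simp add: measurable_cong_sets[OF sets_empirical refl])
  with x show "(\<integral>\<^sup>+ z. h z \<partial>empirical \<Xi> n x) = (\<Sum>j = 1..n. h (x j)) / of_nat n"
    by (rule nn_integral_empirical)
qed fact

text \<open>The coupling is the law of \<open>(X w, x j)\<close> when \<open>(j, w)\<close> has
  density \<open>f j w\<close> with respect to counting measure times \<open>M\<close>. Working on a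
  space \<open>M\<close> above \<open>P\<close> lets the densities depend on more than a point of
  \<open>P\<close>; in the triangle inequality \<open>M\<close> is itself a coupling and
  \<open>X\<close> its second projection.\<close>

lemma (in uniform_on_points) transport_cost_le_plan:
  assumes "prob_space M" and X[measurable]: "X \<in> measurable M P" and P: "distr M P X = P"
    and sets_P[measurable_cong]: "sets P = sets E"
    and f: "f \<in> transport_plans n M"
    and c: "case_prod c \<in> borel_measurable (E \<Otimes>\<^sub>M E)"
  shows "transport_cost c P E \<le> (\<Sum>j = 1..n. \<integral>\<^sup>+ w. f j w * c (X w) (x j) \<partial>M)"
proof -
  interpret M: prob_space M by fact
  let ?C = "count_space {1..n}"
  note [measurable] = transport_plans_measurable[OF f]
  define F where "F v = f (fst v) (snd v)" for v
  define Y where "Y v = (X (snd v), x (fst v))" for v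
  define D where "D = density (?C \<Otimes>\<^sub>M M) F"
  define \<gamma> where "\<gamma> = distr D (P \<Otimes>\<^sub>M E) Y"
  have F[measurable]: "F \<in> borel_measurable (?C \<Otimes>\<^sub>M M)"
    by (rule measurable_pair_measure_countable1) (auto simp: F_def)
  have Y[measurable]: "Y \<in> measurable (?C \<Otimes>\<^sub>M M) (P \<Otimes>\<^sub>M E)"
    using x by (intro measurable_pair_measure_countable1) (auto simp: Y_def)
  \<comment> \<open>Both marginals and the cost of \<open>\<gamma>\<close> are instances of this
    formula.\<close>
  have integral_\<gamma>: "(\<integral>\<^sup>+ z. h z \<partial>\<gamma>) = (\<Sum>j = 1..n. \<integral>\<^sup>+ w. f j w * h (X w, x j) \<partial>M)"
    if h[measurable]: "h \<in> borel_measurable (P \<Otimes>\<^sub>M E)" for h :: "'a \<times> 'a \<Rightarrow> ennreal"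
  proof -
    have Y': "Y \<in> measurable D (P \<Otimes>\<^sub>M E)"
      using Y by (simp add: D_def)
    have hY[measurable]: "(\<lambda>v. h (Y v)) \<in> borel_measurable (?C \<Otimes>\<^sub>M M)"
      by (rule measurable_compose[OF Y h])
    have "(\<integral>\<^sup>+ z. h z \<partial>\<gamma>) = (\<integral>\<^sup>+ v. h (Y v) \<partial>D)"
      unfolding \<gamma>_def by (rule nn_integral_distr[OF Y']) (simp add: h)
    also have "\<dots> = (\<integral>\<^sup>+ v. F v * h (Y v) \<partial>(?C \<Otimes>\<^sub>M M))"
      unfolding D_def by (rule nn_integral_density[OF F hY])
    also have "\<dots> = (\<integral>\<^sup>+ j. \<integral>\<^sup>+ w. F (j, w) * h (Y (j, w)) \<partial>M \<partial>?C)"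
      by (rule M.nn_integral_fst[symmetric]) measurable
    finally show ?thesis
      by (simp add: nn_integral_count_space_finite F_def Y_def)
  qed
  have "\<gamma> \<in> couplings P E"
    unfolding couplings_def
  proof (intro CollectI conjI measure_eqI)
    fix B assume "B \<in> sets (distr \<gamma> P fst)"
    then have B[measurable]: "B \<in> sets P" by simp
    have "emeasure (distr \<gamma> P fst) B = (\<integral>\<^sup>+ z. indicator B (fst z) \<partial>\<gamma>)"
      by (subst nn_integral_indicator[symmetric], simp, subst nn_integral_distr) (auto simp: \<gamma>_def)
    also have "\<dots> = (\<integral>\<^sup>+ w. indicator B (X w) \<partial>M)"
      using nn_integral_transport_plans_mult[OF f] by (subst integral_\<gamma>) auto
    also have "\<dots> = emeasure (distr M P X) B"
      by (subst nn_integral_indicator[symmetric], simp, subst nn_integral_distr) auto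
    finally show "emeasure (distr \<gamma> P fst) B = emeasure P B"
      by (simp add: P)
  next
    fix B assume "B \<in> sets (distr \<gamma> E snd)"
    then have B[measurable]: "B \<in> sets E" by simp
    have "emeasure (distr \<gamma> E snd) B = (\<integral>\<^sup>+ z. indicator B (snd z) \<partial>\<gamma>)"
      by (subst nn_integral_indicator[symmetric], simp, subst nn_integral_distr) (auto simp: \<gamma>_def)
    also have "\<dots> = (\<Sum>j = 1..n. \<integral>\<^sup>+ w. f j w * indicator B (x j) \<partial>M)"
      by (subst integral_\<gamma>) auto
    also have "\<dots> = (\<Sum>j = 1..n. 1 / of_nat n * indicator B (x j))"
      using transport_plans_integral[OF f] by (intro sum.cong refl) (auto simp: nn_integral_multc)
    also have "\<dots> = emeasure E B"
      using integral_E[of "indicator B"] by (subst sum_one_div_mult_ennreal) simp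
    finally show "emeasure (distr \<gamma> E snd) B = emeasure E B" .
  qed (simp_all add: \<gamma>_def)
  then have "transport_cost c P E \<le> (\<integral>\<^sup>+ (y, z). c y z \<partial>\<gamma>)"
    unfolding transport_cost_def by (rule INF_lower)
  also have "\<dots> = (\<Sum>j = 1..n. \<integral>\<^sup>+ w. f j w * c (X w) (x j) \<partial>M)"
    using c by (subst integral_\<gamma>) auto
  finally show ?thesis .
qed

text \<open>The part of \<open>\<gamma>\<close> that lies over the atom \<open>x j\<close>,
  projected to the first coordinate, is absolutely continuous with respect to \<open>P\<close>; its
  Radon-Nikodym density is \<open>f j\<close>. The plan is built before any cost is chosen, so the
  same \<open>f\<close> serves every \<open>c\<close>.\<close>

lemma (in uniform_on_points) coupling_plan:
  assumes "prob_space P" and sets_P[measurable_cong]: "sets P = sets E"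
    and \<gamma>: "\<gamma> \<in> couplings P E"
  obtains f where "f \<in> transport_plans n P"
    and "\<And>c. case_prod c \<in> borel_measurable (E \<Otimes>\<^sub>M E) \<Longrightarrow>
          (\<Sum>j = 1..n. \<integral>\<^sup>+ y. f j y * c y (x j) \<partial>P) = (\<integral>\<^sup>+ (y, z). c y z \<partial>\<gamma>)"
proof -
  interpret P: prob_space P by fact
  have sets_\<gamma>[measurable_cong]: "sets \<gamma> = sets (E \<Otimes>\<^sub>M E)"
    using couplingsD(1)[OF \<gamma>] by (simp add: sets_P cong: sets_pair_measure_cong)
  note x[measurable] sing[measurable]
  define m :: "'a \<Rightarrow> ennreal" where "m z = (\<Sum>i = 1..n. indicator {x i} z)" for z
  \<comment> \<open>Points may repeat among the \<open>x j\<close>; dividing by the multiplicity \<open>m\<close> makes the masses equal.\<close>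
  define w :: "nat \<Rightarrow> 'a \<Rightarrow> ennreal" where "w j z = indicator {x j} z / m z" for j z
  have [measurable]: "m \<in> borel_measurable E"
    unfolding m_def by measurable
  have [measurable]: "w j \<in> borel_measurable E" if "j \<in> {1..n}" for j
    using that unfolding w_def by measurable
  have m_x: "m (x j) \<noteq> 0" if "j \<in> {1..n}" for j
    using that by (auto simp: m_def indicator_def)
  have m_fin: "m z \<noteq> \<infinity>" for z
    by (auto simp: m_def indicator_def)
  have sum_w: "(\<Sum>j = 1..n. w j z) = 1" if "m z \<noteq> 0" for z
    using that m_fin[of z]
  proof -
    have "(\<Sum>j = 1..n. w j z) = m z / m z"
      by (simp add: w_def divide_ennreal_def m_def flip: sum_distrib_right)
    with that m_fin[of z] show ?thesis by (simp add: ennreal_divide_self top.not_eq_extremum)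
  qed
  \<comment> \<open>\<open>E\<close> puts no mass outside the atoms, so the weights
    \<open>w j\<close> form a partition of unity almost everywhere.\<close>
  have AE_m: "AE z in E. m z \<noteq> 0"
  proof -
    let ?h = "\<lambda>z. if m z = 0 then 1 else 0 :: ennreal"
    have "(\<integral>\<^sup>+ z. ?h z \<partial>E) = (\<Sum>j = 1..n. ?h (x j)) / of_nat n"
      by (rule integral_E) auto
    also have "\<dots> = 0"
      using m_x by simp
    finally have "AE z in E. ?h z = 0"
      by (subst (asm) nn_integral_0_iff_AE) auto
    then show ?thesis
      by eventually_elim (auto split: if_splits)
  qed
  have AE_\<gamma>: "AE v in \<gamma>. m (snd v) \<noteq> 0"
    using AE_m by (intro AE_distrD[OF couplingsD(5)[OF \<gamma>], of "\<lambda>z. m z \<noteq> 0"])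
      (subst couplingsD(3)[OF \<gamma>])
  define \<nu> where "\<nu> j = distr (density \<gamma> (\<lambda>v. w j (snd v))) P fst" for j
  have integral_\<nu>: "(\<integral>\<^sup>+ y. h y \<partial>\<nu> j) = (\<integral>\<^sup>+ v. w j (snd v) * h (fst v) \<partial>\<gamma>)"
    if [measurable]: "h \<in> borel_measurable E" and j[measurable]: "j \<in> {1..n}" for j h
    unfolding \<nu>_def by (subst nn_integral_distr, simp, simp, subst nn_integral_density) auto
  have "\<exists>f\<in>borel_measurable P. density P f = \<nu> j" if j[measurable]: "j \<in> {1..n}" for j
  proof (rule P.Radon_Nikodym)
    \<comment> \<open>A null set of \<open>P\<close> is null for the first marginal of
      \<open>\<gamma>\<close>, and reweighting by \<open>w j\<close> keeps it null.\<close>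
    show "absolutely_continuous P (\<nu> j)"
      unfolding absolutely_continuous_def
    proof
      fix B assume B: "B \<in> null_sets P"
      then have [measurable]: "B \<in> sets E" by (auto simp: sets_P)
      have "AE y in P. y \<notin> B"
        using B by (rule AE_not_in)
      then have "AE v in \<gamma>. fst v \<notin> B"
        by (intro AE_distrD[OF couplingsD(4)[OF \<gamma>], of "\<lambda>y. y \<notin> B"])
          (subst couplingsD(2)[OF \<gamma>])
      then have "(\<integral>\<^sup>+ v. w j (snd v) * indicator B (fst v) \<partial>\<gamma>) = 0"
        by (subst nn_integral_0_iff_AE) auto
      then have "(\<integral>\<^sup>+ y. indicator B y \<partial>\<nu> j) = 0"
        using j by (subst integral_\<nu>) auto
      then show "B \<in> null_sets (\<nu> j)"
        by (auto simp: null_sets_def \<nu>_def sets_P)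
    qed
  qed (simp add: \<nu>_def)
  then obtain f where f[measurable]: "\<And>j. j \<in> {1..n} \<Longrightarrow> f j \<in> borel_measurable P"
    and f_\<nu>: "\<And>j. j \<in> {1..n} \<Longrightarrow> density P (f j) = \<nu> j"
    by metis
  have integral_f: "(\<integral>\<^sup>+ y. f j y * h y \<partial>P) = (\<integral>\<^sup>+ v. w j (snd v) * h (fst v) \<partial>\<gamma>)"
    if [measurable]: "h \<in> borel_measurable E" and j[measurable]: "j \<in> {1..n}" for j h
    using integral_\<nu>[OF that] by (subst (asm) f_\<nu>[OF j, symmetric], subst (asm) nn_integral_density) auto
  have sum_f: "(\<Sum>j = 1..n. \<integral>\<^sup>+ y. f j y * c y (x j) \<partial>P) = (\<integral>\<^sup>+ (y, z). c y z \<partial>\<gamma>)"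
    if c: "case_prod c \<in> borel_measurable (E \<Otimes>\<^sub>M E)" for c
  proof -
    have [measurable]: "(\<lambda>y. c y (x j)) \<in> borel_measurable E" if "j \<in> {1..n}" for j
      using measurable_compose[OF _ c, of "\<lambda>y. (y, x j)"] that by simp
    note c[measurable]
    have "(\<Sum>j = 1..n. \<integral>\<^sup>+ y. f j y * c y (x j) \<partial>P) =
        (\<Sum>j = 1..n. \<integral>\<^sup>+ v. w j (snd v) * c (fst v) (x j) \<partial>\<gamma>)"
      by (intro sum.cong refl integral_f) auto
    \<comment> \<open>\<open>w j\<close> vanishes off \<open>x j\<close>, so the atom may be
      replaced by the second coordinate.\<close>
    also have "\<dots> = (\<Sum>j = 1..n. \<integral>\<^sup>+ v. w j (snd v) * case_prod c v \<partial>\<gamma>)"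
      by (intro sum.cong refl nn_integral_cong) (auto simp: w_def split: split_indicator)
    also have "\<dots> = (\<integral>\<^sup>+ v. (\<Sum>j = 1..n. w j (snd v)) * case_prod c v \<partial>\<gamma>)"
      by (subst nn_integral_sum[symmetric]) (auto simp: sum_distrib_right)
    also have "\<dots> = (\<integral>\<^sup>+ v. case_prod c v \<partial>\<gamma>)"
      using AE_\<gamma> by (intro nn_integral_cong_AE, eventually_elim) (subst sum_w; simp)
    finally show ?thesis .
  qed
  have "f \<in> transport_plans n P"
    unfolding transport_plans_def
  proof (intro CollectI conjI ballI)
    fix j assume j: "j \<in> {1..n}"
    show "f j \<in> borel_measurable P" using j by simp
    have "(\<integral>\<^sup>+ y. f j y \<partial>P) = (\<integral>\<^sup>+ v. w j (snd v) \<partial>\<gamma>)"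
      using integral_f[of "\<lambda>_. 1" j] j by simp
    also have "\<dots> = (\<integral>\<^sup>+ z. w j z \<partial>distr \<gamma> E snd)"
      using j by (subst nn_integral_distr) (auto simp: couplingsD(5)[OF \<gamma>])
    also have "\<dots> = (\<Sum>i = 1..n. w j (x i)) / of_nat n"
      using j couplingsD(3)[OF \<gamma>] by (simp add: integral_E)
    \<comment> \<open>Only indices with \<open>x i = x j\<close> contribute, so \<open>i\<close> and
      \<open>j\<close> may change roles; what results is the partition of unity at
      \<open>x j\<close>.\<close>
    also have "(\<Sum>i = 1..n. w j (x i)) = (\<Sum>i = 1..n. indicator {x i} (x j) / m (x j))"
      by (intro sum.cong refl) (auto simp: w_def split: split_indicator)
    also have "\<dots> = (\<Sum>i = 1..n. w i (x j))"
      by (simp add: w_def)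
    also have "\<dots> = 1"
      using sum_w m_x[OF j] by simp
    finally show "(\<integral>\<^sup>+ y. f j y \<partial>P) = 1 / of_nat n" .
  next
    \<comment> \<open>Costs that ignore the atom show that the pieces add up to \<open>P\<close>;
      uniqueness of densities then gives the sum 1.\<close>
    have "density P (\<lambda>y. \<Sum>j = 1..n. f j y) = density P (\<lambda>_. 1)"
    proof (rule measure_eqI)
      fix B assume "B \<in> sets (density P (\<lambda>y. \<Sum>j = 1..n. f j y))"
      then have B[measurable]: "B \<in> sets P" by simp
      then have B'[measurable]: "B \<in> sets E" by (simp add: sets_P)
      have "emeasure (density P (\<lambda>y. \<Sum>j = 1..n. f j y)) B =
          (\<integral>\<^sup>+ y. (\<Sum>j = 1..n. f j y) * indicator B y \<partial>P)"
        by (subst emeasure_density) auto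
      also have "\<dots> = (\<Sum>j = 1..n. \<integral>\<^sup>+ y. f j y * indicator B y \<partial>P)"
        by (subst nn_integral_sum[symmetric]) (auto simp: sum_distrib_right)
      also have "\<dots> = (\<integral>\<^sup>+ (y, z). indicator B y \<partial>\<gamma>)"
        by (rule sum_f) measurable
      also have "\<dots> = (\<integral>\<^sup>+ y. indicator B y \<partial>distr \<gamma> P fst)"
        by (subst nn_integral_distr) (auto simp: case_prod_unfold couplingsD(4)[OF \<gamma>])
      also have "\<dots> = emeasure P B"
        by (simp add: couplingsD(2)[OF \<gamma>])
      finally show "emeasure (density P (\<lambda>y. \<Sum>j = 1..n. f j y)) B = emeasure (density P (\<lambda>_. 1)) B"
        by (simp add: density_1)
    qed simp
    then have "density P (\<lambda>_. 1) = density P (\<lambda>y. \<Sum>j = 1..n. f j y)" by simp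
    then have "AE y in P. 1 = (\<Sum>j = 1..n. f j y)"
      by (subst (asm) finite_density_unique) (auto simp: P.emeasure_space_1)
    then show "AE y in P. (\<Sum>j = 1..n. f j y) = 1"
      by eventually_elim simp
  qed
  with sum_f that show thesis by blast
qed

text \<open>After this reformulation the infimum runs over a set that does not depend on the
  positions of the atoms; these enter through the cost functions alone.\<close>

lemma (in uniform_on_points) transport_cost_eq_plan_cost:
  assumes P: "prob_space P" "sets P = sets E" and c: "case_prod c \<in> borel_measurable (E \<Otimes>\<^sub>M E)"
  shows "transport_cost c P E = plan_cost n P (\<lambda>j y. c y (x j))"
proof (rule antisym)
  show "transport_cost c P E \<le> plan_cost n P (\<lambda>j y. c y (x j))"
    unfolding plan_cost_def
  proof (rule INF_greatest)
    fix f assume "f \<in> transport_plans n P"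
    then show "transport_cost c P E \<le> (\<Sum>j = 1..n. \<integral>\<^sup>+ y. f j y * c y (x j) \<partial>P)"
      using transport_cost_le_plan[of P "\<lambda>y. y" P f c] P c by (simp add: distr_id)
  qed
  show "plan_cost n P (\<lambda>j y. c y (x j)) \<le> transport_cost c P E"
    unfolding transport_cost_def
  proof (rule INF_greatest)
    fix \<gamma> assume "\<gamma> \<in> couplings P E"
    then obtain f where f: "f \<in> transport_plans n P"
      and "\<And>c. case_prod c \<in> borel_measurable (E \<Otimes>\<^sub>M E) \<Longrightarrow>
        (\<Sum>j = 1..n. \<integral>\<^sup>+ y. f j y * c y (x j) \<partial>P) = (\<integral>\<^sup>+ (y, z). c y z \<partial>\<gamma>)"
      by (rule coupling_plan[OF P]) blast
    from this(2)[OF c] have f_eq: "(\<Sum>j = 1..n. \<integral>\<^sup>+ y. f j y * c y (x j) \<partial>P) = (\<integral>\<^sup>+ (y, z). c y z \<partial>\<gamma>)" .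
    show "plan_cost n P (\<lambda>j y. c y (x j)) \<le> (\<integral>\<^sup>+ (y, z). c y z \<partial>\<gamma>)"
      unfolding plan_cost_def f_eq[symmetric] using f by (rule INF_lower)
  qed
qed

section \<open>Dependence of the plan cost on the cost functions\<close>

lemma INF_add_const_ennreal:
  fixes f :: "'i \<Rightarrow> ennreal"
  assumes "I \<noteq> {}"
  shows "(INF i\<in>I. f i + c) = (INF i\<in>I. f i) + c"
  using continuous_at_Inf_mono[of "\<lambda>x. x + c" "f ` I"]
  using continuous_add[of "at_right (Inf (f ` I))" "\<lambda>x. x" "\<lambda>x. c"] assms
  by (auto simp: mono_def image_comp)

text \<open>All densities are at most 1, so replacing \<open>h\<close> by \<open>g\<close> raises
  the cost of any plan by at most the sum of the \<open>L1\<close> distances. The bound is the same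
  for all plans and passes to the infimum.\<close>

lemma plan_cost_lipschitz:
  fixes g h :: "nat \<Rightarrow> 'a \<Rightarrow> real"
  assumes g: "\<And>j. j \<in> {1..n} \<Longrightarrow> g j \<in> borel_measurable P"
    and h: "\<And>j. j \<in> {1..n} \<Longrightarrow> h j \<in> borel_measurable P"
  shows "plan_cost n P (\<lambda>j y. ennreal (g j y)) \<le>
    plan_cost n P (\<lambda>j y. ennreal (h j y)) + (\<Sum>j = 1..n. \<integral>\<^sup>+ y. ennreal \<bar>g j y - h j y\<bar> \<partial>P)"
proof (cases "transport_plans n P = {}")
  case False
  let ?D = "\<Sum>j = 1..n. \<integral>\<^sup>+ y. ennreal \<bar>g j y - h j y\<bar> \<partial>P"
  have "plan_cost n P (\<lambda>j y. ennreal (g j y)) \<le>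
      (INF f\<in>transport_plans n P. (\<Sum>j = 1..n. \<integral>\<^sup>+ y. f j y * ennreal (h j y) \<partial>P) + ?D)"
    unfolding plan_cost_def
  proof (rule INF_mono)
    fix f assume f: "f \<in> transport_plans n P"
    note [measurable] = transport_plans_measurable[OF f] g h
    have "(\<integral>\<^sup>+ y. f j y * ennreal (g j y) \<partial>P) \<le>
        (\<integral>\<^sup>+ y. f j y * ennreal (h j y) \<partial>P) + (\<integral>\<^sup>+ y. ennreal \<bar>g j y - h j y\<bar> \<partial>P)"
      if j: "j \<in> {1..n}" for j
    proof -
      have "(\<integral>\<^sup>+ y. f j y * ennreal (g j y) \<partial>P) \<le>
          (\<integral>\<^sup>+ y. f j y * ennreal (h j y) + ennreal \<bar>g j y - h j y\<bar> \<partial>P)"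
        using transport_plans_le_1[OF f j]
      proof (intro nn_integral_mono_AE, eventually_elim)
        case (elim y)
        \<comment> \<open>The functions may be negative, and \<open>ennreal\<close> truncates them
          at 0; hence the \<open>max\<close>.\<close>
        have "ennreal (g j y) \<le> ennreal (max 0 (h j y) + \<bar>g j y - h j y\<bar>)"
          by (intro ennreal_leI) auto
        also have "\<dots> = ennreal (h j y) + ennreal \<bar>g j y - h j y\<bar>"
          by (subst ennreal_plus) (auto simp: max_def ennreal_neg)
        finally have "f j y * ennreal (g j y) \<le> f j y * (ennreal (h j y) + ennreal \<bar>g j y - h j y\<bar>)"
          by (rule mult_left_mono) simp
        also have "\<dots> \<le> f j y * ennreal (h j y) + 1 * ennreal \<bar>g j y - h j y\<bar>"
          unfolding distrib_left by (intro add_left_mono mult_right_mono elim) simp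
        finally show ?case by simp
      qed
      also have "\<dots> = (\<integral>\<^sup>+ y. f j y * ennreal (h j y) \<partial>P) + (\<integral>\<^sup>+ y. ennreal \<bar>g j y - h j y\<bar> \<partial>P)"
        using j by (intro nn_integral_add) auto
      finally show ?thesis .
    qed
    then have "(\<Sum>j = 1..n. \<integral>\<^sup>+ y. f j y * ennreal (g j y) \<partial>P) \<le>
        (\<Sum>j = 1..n. \<integral>\<^sup>+ y. f j y * ennreal (h j y) \<partial>P) + ?D"
      unfolding sum.distrib[symmetric] by (rule sum_mono)
    with f show "\<exists>f'\<in>transport_plans n P. (\<Sum>j = 1..n. \<integral>\<^sup>+ y. f' j y * ennreal (g j y) \<partial>P) \<le>
        (\<Sum>j = 1..n. \<integral>\<^sup>+ y. f j y * ennreal (h j y) \<partial>P) + ?D"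
      by blast
  qed
  also have "\<dots> = plan_cost n P (\<lambda>j y. ennreal (h j y)) + ?D"
    unfolding plan_cost_def by (rule INF_add_const_ennreal[OF False])
  finally show ?thesis .
qed (simp add: plan_cost_def)

text \<open>Since all cost functions \<open>c(\<cdot>, x)\<close> are comparable, one non-integrable cost function makes every
  transport cost infinite, wherever the atoms are.\<close>

lemma plan_cost_eq_top:
  fixes c :: "'a \<Rightarrow> 'b \<Rightarrow> real"
  assumes "prob_space P" and C: "C \<ge> 0" and D: "D \<ge> 0"
    and x0: "(\<lambda>y. c y x0) \<in> borel_measurable P" "(\<integral>\<^sup>+ y. ennreal (c y x0) \<partial>P) = \<infinity>"
    and x: "\<And>j. j \<in> {1..n} \<Longrightarrow> (\<lambda>y. c y (x j)) \<in> borel_measurable P"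
    and nonneg: "\<And>j y. j \<in> {1..n} \<Longrightarrow> y \<in> space P \<Longrightarrow> 0 \<le> c y (x j)"
    and bound: "\<And>j y. j \<in> {1..n} \<Longrightarrow> y \<in> space P \<Longrightarrow> c y x0 \<le> C * c y (x j) + D"
  shows "plan_cost n P (\<lambda>j y. ennreal (c y (x j))) = \<infinity>"
proof -
  have "(\<Sum>j = 1..n. \<integral>\<^sup>+ y. f j y * ennreal (c y (x j)) \<partial>P) = \<infinity>"
    if f: "f \<in> transport_plans n P" for f
  proof -
    interpret prob_space P by fact
    note [measurable] = transport_plans_measurable[OF f] x0(1) x
    \<comment> \<open>The infinite integral is split along the plan and each piece compared with its
      own atom. This bounds it by a multiple of the cost of the plan plus the constant
      \<open>D\<close>, so that cost is infinite.\<close>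
    have "\<infinity> = (\<Sum>j = 1..n. \<integral>\<^sup>+ y. f j y * ennreal (c y x0) \<partial>P)"
      by (subst nn_integral_transport_plans_mult[OF f]) (auto simp: x0)
    also have "\<dots> \<le> (\<Sum>j = 1..n. ennreal C * (\<integral>\<^sup>+ y. f j y * ennreal (c y (x j)) \<partial>P) + (\<integral>\<^sup>+ y. f j y * ennreal D \<partial>P))"
    proof (rule sum_mono)
      fix j assume j: "j \<in> {1..n}"
      have "(\<integral>\<^sup>+ y. f j y * ennreal (c y x0) \<partial>P) \<le>
          (\<integral>\<^sup>+ y. ennreal C * (f j y * ennreal (c y (x j))) + f j y * ennreal D \<partial>P)"
      proof (rule nn_integral_mono)
        fix y assume y: "y \<in> space P"
        have "f j y * ennreal (c y x0) \<le> f j y * ennreal (C * c y (x j) + D)"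
          by (intro mult_left_mono ennreal_leI bound j y) simp
        also have "\<dots> = ennreal C * (f j y * ennreal (c y (x j))) + f j y * ennreal D"
          using C D nonneg[OF j y] by (simp add: ennreal_mult distrib_left mult_ac)
        finally show "f j y * ennreal (c y x0) \<le> \<dots>" .
      qed
      also have "\<dots> = ennreal C * (\<integral>\<^sup>+ y. f j y * ennreal (c y (x j)) \<partial>P) + (\<integral>\<^sup>+ y. f j y * ennreal D \<partial>P)"
        using j by (subst nn_integral_add) (auto simp: nn_integral_cmult)
      finally show "(\<integral>\<^sup>+ y. f j y * ennreal (c y x0) \<partial>P) \<le> \<dots>" .
    qed
    also have "\<dots> = ennreal C * (\<Sum>j = 1..n. \<integral>\<^sup>+ y. f j y * ennreal (c y (x j)) \<partial>P) + ennreal D"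
      by (subst sum.distrib, subst nn_integral_transport_plans_mult[OF f])
        (auto simp: sum_distrib_left emeasure_space_1)
    finally show ?thesis
      by (auto simp: top_unique ennreal_mult_eq_top_iff)
  qed
  then show ?thesis
    by (auto simp: plan_cost_def)
qed

subsection \<open>Measurable dependence of the transport cost on the atoms\<close>

text \<open>The sections \<open>u(\<cdot>, x)\<close> lie in a separable subset of \<open>L\<^sup>1(P)\<close>.\<close>

definition separable_sections :: "'a measure \<Rightarrow> 'b measure \<Rightarrow> ('a \<times> 'b \<Rightarrow> real) \<Rightarrow> bool" where
  "separable_sections P S u \<longleftrightarrow>
    (\<exists>H. countable H \<and> H \<subseteq> borel_measurable P \<and>
      (\<forall>x\<in>space S. \<forall>e>0. \<exists>h\<in>H. (\<integral>\<^sup>+ y. ennreal \<bar>u (y, x) - h y\<bar> \<partial>P) < ennreal e))"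

text \<open>The union of the countable families of all \<open>U i\<close> works: half of
  \<open>e\<close> is spent on passing from \<open>u\<close> to some \<open>U i\<close>, half on
  approximating \<open>U i\<close>. The index \<open>i\<close> may depend on \<open>x\<close>, so no
  uniformity in \<open>x\<close> is required.\<close>

lemma separable_sections_limit:
  assumes U: "\<And>i::nat. separable_sections P S (U i)"
    and meas: "\<And>i. U i \<in> borel_measurable (P \<Otimes>\<^sub>M S)" "u \<in> borel_measurable (P \<Otimes>\<^sub>M S)"
    and lim: "\<And>x. x \<in> space S \<Longrightarrow> (\<lambda>i. \<integral>\<^sup>+ y. ennreal \<bar>u (y, x) - U i (y, x)\<bar> \<partial>P) \<longlonglongrightarrow> 0"
  shows "separable_sections P S u"
proof -
  obtain H where H: "\<And>i. countable (H i)" "\<And>i. H i \<subseteq> borel_measurable P"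
    "\<And>i x e. x \<in> space S \<Longrightarrow> e > 0 \<Longrightarrow> \<exists>h\<in>H i. (\<integral>\<^sup>+ y. ennreal \<bar>U i (y, x) - h y\<bar> \<partial>P) < ennreal e"
    using U unfolding separable_sections_def by metis
  have "\<exists>h\<in>(\<Union>i. H i). (\<integral>\<^sup>+ y. ennreal \<bar>u (y, x) - h y\<bar> \<partial>P) < ennreal e" if x: "x \<in> space S" and e: "e > 0" for x e
  proof -
    define d where "d = e / 2"
    have d: "0 < d" "ennreal d + ennreal d = ennreal e"
      using e by (auto simp: d_def simp flip: ennreal_plus)
    have [measurable]: "(\<lambda>y. u (y, x)) \<in> borel_measurable P" "\<And>i. (\<lambda>y. U i (y, x)) \<in> borel_measurable P"
      using x meas by (auto intro: measurable_compose[OF measurable_Pair2'])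
    from order_tendstoD(2)[OF lim[OF x], of "ennreal d"] d(1) obtain i
      where i: "(\<integral>\<^sup>+ y. ennreal \<bar>u (y, x) - U i (y, x)\<bar> \<partial>P) < ennreal d"
      by (force simp: eventually_sequentially)
    from H(3)[OF x d(1), of i] obtain h where h: "h \<in> H i" "(\<integral>\<^sup>+ y. ennreal \<bar>U i (y, x) - h y\<bar> \<partial>P) < ennreal d"
      by blast
    have [measurable]: "h \<in> borel_measurable P" using h H(2) by blast
    have "(\<integral>\<^sup>+ y. ennreal \<bar>u (y, x) - h y\<bar> \<partial>P) \<le>
        (\<integral>\<^sup>+ y. ennreal \<bar>u (y, x) - U i (y, x)\<bar> + ennreal \<bar>U i (y, x) - h y\<bar> \<partial>P)"
      by (intro nn_integral_mono) (auto simp flip: ennreal_plus intro!: ennreal_leI)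
    also have "\<dots> = (\<integral>\<^sup>+ y. ennreal \<bar>u (y, x) - U i (y, x)\<bar> \<partial>P) + (\<integral>\<^sup>+ y. ennreal \<bar>U i (y, x) - h y\<bar> \<partial>P)"
      by (rule nn_integral_add) auto
    also have "\<dots> < ennreal d + ennreal d"
      using i h(2) by (rule add_strict_mono)
    finally show ?thesis
      using d h by auto
  qed
  with H(1,2) show ?thesis
    unfolding separable_sections_def by (intro exI[of _ "\<Union>i. H i"]) auto
qed

lemma separable_sections_add:
  assumes "separable_sections P S u" "separable_sections P S v"
    and meas: "u \<in> borel_measurable (P \<Otimes>\<^sub>M S)" "v \<in> borel_measurable (P \<Otimes>\<^sub>M S)"
  shows "separable_sections P S (\<lambda>z. u z + v z)"
proof -
  obtain H where H: "countable H" "H \<subseteq> borel_measurable P"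
    "\<And>x e. x \<in> space S \<Longrightarrow> e > 0 \<Longrightarrow> \<exists>h\<in>H. (\<integral>\<^sup>+ y. ennreal \<bar>u (y, x) - h y\<bar> \<partial>P) < ennreal e"
    using assms(1) unfolding separable_sections_def by blast
  obtain K where K: "countable K" "K \<subseteq> borel_measurable P"
    "\<And>x e. x \<in> space S \<Longrightarrow> e > 0 \<Longrightarrow> \<exists>k\<in>K. (\<integral>\<^sup>+ y. ennreal \<bar>v (y, x) - k y\<bar> \<partial>P) < ennreal e"
    using assms(2) unfolding separable_sections_def by blast
  let ?L = "(\<lambda>(h, k) y. h y + k y) ` (H \<times> K)"
  have "\<exists>l\<in>?L. (\<integral>\<^sup>+ y. ennreal \<bar>u (y, x) + v (y, x) - l y\<bar> \<partial>P) < ennreal e" if x: "x \<in> space S" and e: "e > 0" for x e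
  proof -
    define d where "d = e / 2"
    have d: "0 < d" "ennreal d + ennreal d = ennreal e"
      using e by (auto simp: d_def simp flip: ennreal_plus)
    have [measurable]: "(\<lambda>y. u (y, x)) \<in> borel_measurable P" "(\<lambda>y. v (y, x)) \<in> borel_measurable P"
      using x meas by (auto intro: measurable_compose[OF measurable_Pair2'])
    obtain h k where h: "h \<in> H" "(\<integral>\<^sup>+ y. ennreal \<bar>u (y, x) - h y\<bar> \<partial>P) < ennreal d"
      and k: "k \<in> K" "(\<integral>\<^sup>+ y. ennreal \<bar>v (y, x) - k y\<bar> \<partial>P) < ennreal d"
      using H(3)[OF x d(1)] K(3)[OF x d(1)] by blast
    have [measurable]: "h \<in> borel_measurable P" "k \<in> borel_measurable P" using h k H(2) K(2) by auto
    have "(\<integral>\<^sup>+ y. ennreal \<bar>u (y, x) + v (y, x) - (h y + k y)\<bar> \<partial>P) \<le>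
        (\<integral>\<^sup>+ y. ennreal \<bar>u (y, x) - h y\<bar> + ennreal \<bar>v (y, x) - k y\<bar> \<partial>P)"
      by (intro nn_integral_mono) (auto simp flip: ennreal_plus intro!: ennreal_leI)
    also have "\<dots> = (\<integral>\<^sup>+ y. ennreal \<bar>u (y, x) - h y\<bar> \<partial>P) + (\<integral>\<^sup>+ y. ennreal \<bar>v (y, x) - k y\<bar> \<partial>P)"
      by (rule nn_integral_add) auto
    also have "\<dots> < ennreal d + ennreal d"
      using h(2) k(2) by (rule add_strict_mono)
    finally have "(\<integral>\<^sup>+ y. ennreal \<bar>u (y, x) + v (y, x) - (h y + k y)\<bar> \<partial>P) < ennreal e"
      using d by simp
    with h k show ?thesis
      by (intro bexI[of _ "\<lambda>y. h y + k y"]) auto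
  qed
  moreover have "?L \<subseteq> borel_measurable P"
    using H(2) K(2) by (auto intro!: borel_measurable_add)
  ultimately show ?thesis
    unfolding separable_sections_def using H(1) K(1) by (intro exI[of _ ?L]) auto
qed

lemma separable_sections_cmult:
  assumes "separable_sections P S u" and meas: "u \<in> borel_measurable (P \<Otimes>\<^sub>M S)"
  shows "separable_sections P S (\<lambda>z. a * u z)"
proof (cases "a = 0")
  case True
  then show ?thesis
    unfolding separable_sections_def by (intro exI[of _ "{\<lambda>_. 0}"]) auto
next
  case False
  obtain H where H: "countable H" "H \<subseteq> borel_measurable P"
    "\<And>x e. x \<in> space S \<Longrightarrow> e > 0 \<Longrightarrow> \<exists>h\<in>H. (\<integral>\<^sup>+ y. ennreal \<bar>u (y, x) - h y\<bar> \<partial>P) < ennreal e"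
    using assms unfolding separable_sections_def by metis
  let ?L = "(\<lambda>h y. a * h y) ` H"
  have "\<exists>l\<in>?L. (\<integral>\<^sup>+ y. ennreal \<bar>a * u (y, x) - l y\<bar> \<partial>P) < ennreal e" if x: "x \<in> space S" and e: "e > 0" for x e
  proof -
    have [measurable]: "(\<lambda>y. u (y, x)) \<in> borel_measurable P"
      using x meas by (auto intro: measurable_compose[OF measurable_Pair2'])
    have "e / \<bar>a\<bar> > 0"
      using False e by simp
    then obtain h where h: "h \<in> H" "(\<integral>\<^sup>+ y. ennreal \<bar>u (y, x) - h y\<bar> \<partial>P) < ennreal (e / \<bar>a\<bar>)"
      using H(3)[OF x] by blast
    have [measurable]: "h \<in> borel_measurable P" using h H(2) by auto
    have "(\<integral>\<^sup>+ y. ennreal \<bar>a * u (y, x) - a * h y\<bar> \<partial>P) =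
        ennreal \<bar>a\<bar> * (\<integral>\<^sup>+ y. ennreal \<bar>u (y, x) - h y\<bar> \<partial>P)"
      by (subst nn_integral_cmult[symmetric])
        (auto simp: ennreal_mult[symmetric] abs_mult[symmetric] right_diff_distrib)
    also have "\<dots> < ennreal \<bar>a\<bar> * ennreal (e / \<bar>a\<bar>)"
      using h(2) False by (intro ennreal_mult_strict_left_mono) auto
    also have "\<dots> = ennreal e"
      using False e by (simp add: ennreal_mult[symmetric])
    finally show ?thesis
      using h by (intro bexI[of _ "\<lambda>y. a * h y"]) auto
  qed
  moreover have "?L \<subseteq> borel_measurable P"
    using H(2) by auto
  ultimately show ?thesis
    unfolding separable_sections_def using H(1) by (intro exI[of _ ?L]) auto
qed

lemma separable_sections_cong:
  assumes "separable_sections P S u"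
    and "\<And>y x. y \<in> space P \<Longrightarrow> x \<in> space S \<Longrightarrow> u (y, x) = v (y, x)"
  shows "separable_sections P S v"
proof -
  have "(\<integral>\<^sup>+ y. ennreal \<bar>u (y, x) - h y\<bar> \<partial>P) = (\<integral>\<^sup>+ y. ennreal \<bar>v (y, x) - h y\<bar> \<partial>P)"
    if "x \<in> space S" for x h
    using assms(2) that by (intro nn_integral_cong) auto
  with assms(1) show ?thesis
    unfolding separable_sections_def by auto
qed

text \<open>Induction from rectangles, whose sections are either the indicator of one fixed set or
  0. Complements come from \<open>1 - indicator A\<close>, disjoint unions from dominated
  convergence with the constant 1, which is integrable since \<open>P\<close> is finite.\<close>

lemma separable_sections_indicator:
  assumes "finite_measure P" and A: "A \<in> sets (P \<Otimes>\<^sub>M S)"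
  shows "separable_sections P S (indicator A)"
proof -
  interpret finite_measure P by fact
  have const: "separable_sections P S (\<lambda>_. r)" for r :: real
    unfolding separable_sections_def by (intro exI[of _ "{\<lambda>_. r}"]) auto
  show ?thesis
    using Int_stable_pair_measure_generator pair_measure_closed A
    unfolding sets_pair_measure
  proof (induct rule: sigma_sets_induct_disjoint)
    case (basic A)
    then obtain a b where A: "A = a \<times> b" and a: "a \<in> sets P" by auto
    have "\<exists>h\<in>{indicator a, \<lambda>_. 0}. (\<integral>\<^sup>+ y. ennreal \<bar>indicator A (y, x) - h y\<bar> \<partial>P) < ennreal e"
      if "e > 0" for x e
      using that by (cases "x \<in> b") (auto simp: A indicator_times)
    then show ?case
      unfolding separable_sections_def using a by (intro exI[of _ "{indicator a, \<lambda>_. 0}"]) auto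
  next
    case empty
    then show ?case using const[of 0] by (simp add: indicator_def[abs_def])
  next
    case (compl A)
    then have [measurable]: "A \<in> sets (P \<Otimes>\<^sub>M S)" by (simp add: sets_pair_measure)
    have "separable_sections P S (\<lambda>z. 1 + (- 1) * indicator A z)"
      by (intro separable_sections_add separable_sections_cmult const compl) auto
    then show ?case
      by (rule separable_sections_cong) (auto split: split_indicator)
  next
    case (union A)
    then have [measurable]: "A i \<in> sets (P \<Otimes>\<^sub>M S)" for i
      by (auto simp: sets_pair_measure)
    have sums: "separable_sections P S (\<lambda>z. \<Sum>i<k. indicator (A i) z)" for k
    proof (induction k)
      case 0
      then show ?case using const[of 0] by simp
    next
      case (Suc k)
      then show ?case
        by (simp, intro separable_sections_add union) auto
    qed
    \<comment> \<open>Disjointness turns the partial sums, which are covered by the closure under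
      addition, into indicators of partial unions.\<close>
    have ind: "(\<Sum>i<k. indicator (A i) z) = (indicator (\<Union>i<k. A i) z :: real)" for k z
      using union(1) by (subst indicator_UN_disjoint) (auto simp: disjoint_family_on_def)
    show ?case
    proof (rule separable_sections_limit[OF sums[unfolded ind]])
      fix x assume x: "x \<in> space S"
      have m: "(\<lambda>y. indicator B (y, x) :: real) \<in> borel_measurable P" if "B \<in> sets (P \<Otimes>\<^sub>M S)" for B
        using that x by (auto intro: measurable_compose[OF measurable_Pair2'])
      have "(\<lambda>k. \<integral>\<^sup>+ y. ennreal (norm (indicator (\<Union>i. A i) (y, x) - indicator (\<Union>i<k. A i) (y, x) :: real)) \<partial>P) \<longlonglongrightarrow> 0"
      proof (rule nn_integral_dominated_convergence_norm[where w = "\<lambda>_. 1"])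
        show "AE y in P. (\<lambda>k. indicator (\<Union>i<k. A i) (y, x) :: real) \<longlonglongrightarrow> indicator (\<Union>i. A i) (y, x)"
          by (intro AE_I2 LIMSEQ_indicator_UN)
      qed (auto intro!: m simp: emeasure_eq_measure split: split_indicator)
      then show "(\<lambda>k. \<integral>\<^sup>+ y. ennreal \<bar>indicator (\<Union>i. A i) (y, x) - indicator (\<Union>i<k. A i) (y, x) :: real\<bar> \<partial>P) \<longlonglongrightarrow> 0"
        by simp
    qed auto
  qed
qed

text \<open>Passes from indicators to nonnegative functions by monotone approximation.\<close>

lemma separable_sections_measurable:
  assumes "finite_measure P" and u: "u \<in> borel_measurable (P \<Otimes>\<^sub>M S)" "\<And>z. 0 \<le> u z"
    and fin: "\<And>x. x \<in> space S \<Longrightarrow> (\<integral>\<^sup>+ y. ennreal (u (y, x)) \<partial>P) < \<top>"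
  shows "separable_sections P S u"
proof -
  have sect: "(\<lambda>y. v (y, x)) \<in> borel_measurable P"
    if "v \<in> borel_measurable (P \<Otimes>\<^sub>M S)" "x \<in> space S" for v :: "_ \<Rightarrow> real" and x
    using that by (auto intro: measurable_compose[OF measurable_Pair2'])
  have mono: "(\<integral>\<^sup>+ y. ennreal (v (y, x)) \<partial>P) < \<top>"
    if "(\<integral>\<^sup>+ y. ennreal (w (y, x)) \<partial>P) < \<top>" "\<And>y. y \<in> space P \<Longrightarrow> v (y, x) \<le> w (y, x)" for v w :: "_ \<Rightarrow> real" and x
    using that by (elim le_less_trans[rotated]) (auto intro!: nn_integral_mono ennreal_leI)
  \<comment> \<open>Integrability of the sections is part of the claim, as each induction step must
    hand it down to the functions from which \<open>u\<close> is built.\<close>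
  have "(\<forall>x\<in>space S. (\<integral>\<^sup>+ y. ennreal (u (y, x)) \<partial>P) < \<top>) \<longrightarrow> separable_sections P S u"
    using u
  proof (induction rule: borel_measurable_induct_real)
    case (set A)
    then show ?case using separable_sections_indicator[OF assms(1)] by blast
  next
    case (mult u a)
    show ?case
    proof (cases "a = 0")
      case True
      then show ?thesis
        unfolding separable_sections_def by (intro impI exI[of _ "{\<lambda>_. 0}"]) auto
    next
      case False
      have "(\<integral>\<^sup>+ y. ennreal (u (y, x)) \<partial>P) < \<top>"
        if "(\<integral>\<^sup>+ y. ennreal (a * u (y, x)) \<partial>P) < \<top>" "x \<in> space S" for x
      proof -
        have "(\<integral>\<^sup>+ y. ennreal (a * u (y, x)) \<partial>P) = ennreal a * (\<integral>\<^sup>+ y. ennreal (u (y, x)) \<partial>P)"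
          using mult that sect by (subst nn_integral_cmult[symmetric]) (auto simp: ennreal_mult)
        with that mult(1) False show ?thesis
          by (auto simp: ennreal_mult_less_top)
      qed
      with mult show ?thesis by (auto intro!: separable_sections_cmult)
    qed
  next
    case (add u v)
    show ?case
    proof
      assume fin: "\<forall>x\<in>space S. (\<integral>\<^sup>+ y. ennreal (v (y, x) + u (y, x)) \<partial>P) < \<top>"
      have "(\<integral>\<^sup>+ y. ennreal (u (y, x)) \<partial>P) < \<top>" "(\<integral>\<^sup>+ y. ennreal (v (y, x)) \<partial>P) < \<top>" if "x \<in> space S" for x
      proof -
        have *: "(\<integral>\<^sup>+ y. ennreal (v (y, x) + u (y, x)) \<partial>P) < \<top>"
          using fin that by blast
        have "0 \<le> u z" "0 \<le> v z" for z
          using add by auto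
        then show "(\<integral>\<^sup>+ y. ennreal (u (y, x)) \<partial>P) < \<top>" "(\<integral>\<^sup>+ y. ennreal (v (y, x)) \<partial>P) < \<top>"
          by (auto intro!: mono[of "\<lambda>z. v z + u z" x u] mono[of "\<lambda>z. v z + u z" x v] * simp del: ennreal_plus)
      qed
      with add show "separable_sections P S (\<lambda>z. v z + u z)"
        by (intro separable_sections_add) auto
    qed
  next
    case (seq U)
    show ?case
    proof
      assume fin: "\<forall>x\<in>space S. (\<integral>\<^sup>+ y. ennreal (u (y, x)) \<partial>P) < \<top>"
      have le: "U i (y, x) \<le> u (y, x)" if "y \<in> space P" "x \<in> space S" for i y x
        using seq.hyps(3,4) that by (intro incseq_le) (auto simp: space_pair_measure incseq_def le_fun_def)
      show "separable_sections P S u"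
      proof (rule separable_sections_limit[of P S U])
        fix i
        show "separable_sections P S (U i)"
          using seq.IH[of i] fin le by (auto intro: mono[of u])
        show "U i \<in> borel_measurable (P \<Otimes>\<^sub>M S)" by (rule seq.hyps)
      next
        show "u \<in> borel_measurable (P \<Otimes>\<^sub>M S)" by (rule u)
      next
        fix x assume x: "x \<in> space S"
        have "(\<lambda>k. \<integral>\<^sup>+ y. ennreal (norm (u (y, x) - U k (y, x))) \<partial>P) \<longlonglongrightarrow> 0"
        \<comment> \<open>The limit itself is an integrable majorant.\<close>
        proof (rule nn_integral_dominated_convergence_norm[where w = "\<lambda>y. u (y, x)"])
          show "AE y in P. (\<lambda>k. U k (y, x)) \<longlonglongrightarrow> u (y, x)"
            using seq.hyps(4) x by (intro AE_I2) (auto simp: space_pair_measure)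
          show "AE y in P. norm (U k (y, x)) \<le> u (y, x)" for k
            using seq.hyps(2) le x by (intro AE_I2) auto
        qed (use seq.hyps(1) u sect x fin in auto)
        then show "(\<lambda>k. \<integral>\<^sup>+ y. ennreal \<bar>u (y, x) - U k (y, x)\<bar> \<partial>P) \<longlonglongrightarrow> 0"
          by simp
      qed
    qed
  qed
  with fin show ?thesis by blast
qed

text \<open>By the Lipschitz bound above, the infimum over a countable set of cost functions that is dense among the
  \<open>c(\<cdot>, x\<^sub>j)\<close> computes the transport cost, which is therefore measurable in \<open>x\<close>.\<close>

lemma measurable_plan_cost:
  fixes c :: "'a \<Rightarrow> 'b \<Rightarrow> real"
  assumes P: "finite_measure P" and c: "case_prod c \<in> borel_measurable (P \<Otimes>\<^sub>M S)"
    and nonneg: "\<And>y x. 0 \<le> c y x"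
    and fin: "\<And>x. x \<in> space S \<Longrightarrow> (\<integral>\<^sup>+ y. ennreal (c y x) \<partial>P) < \<top>"
  shows "(\<lambda>x. plan_cost n P (\<lambda>j y. ennreal (c y (x j)))) \<in> borel_measurable (\<Pi>\<^sub>M j\<in>{1..n}. S)"
proof -
  interpret finite_measure P by fact
  have "separable_sections P S (case_prod c)"
    using P c nonneg fin by (intro separable_sections_measurable) auto
  then obtain H where H: "countable H" "H \<subseteq> borel_measurable P"
    "\<And>x e. x \<in> space S \<Longrightarrow> e > 0 \<Longrightarrow> \<exists>h\<in>H. (\<integral>\<^sup>+ y. ennreal \<bar>c y x - h y\<bar> \<partial>P) < ennreal e"
    unfolding separable_sections_def by auto
  let ?K = "{1..n} \<rightarrow>\<^sub>E H" and ?\<Pi> = "\<Pi>\<^sub>M j\<in>{1..n}. S"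
  let ?dist = "\<lambda>x k. \<Sum>j = 1..n. \<integral>\<^sup>+ y. ennreal \<bar>c y (x j) - k j y\<bar> \<partial>P"
  let ?approx = "\<lambda>k x. plan_cost n P (\<lambda>j y. ennreal (k j y)) + ?dist x k"
  have sect: "(\<lambda>y. c y x) \<in> borel_measurable P" if "x \<in> space S" for x
    using measurable_compose[OF measurable_Pair2'[OF that] c] by simp
  \<comment> \<open>Every \<open>?approx k\<close> is an upper bound by the Lipschitz estimate. For
    \<open>k\<close> close to the true costs, the reverse estimate shows that it exceeds the plan
    cost by at most twice the distance.\<close>
  have eq: "plan_cost n P (\<lambda>j y. ennreal (c y (x j))) = (INF k\<in>?K. ?approx k x)"
    if x: "x \<in> space ?\<Pi>" for x
  proof (rule antisym)
    have x_j: "x j \<in> space S" if "j \<in> {1..n}" for j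
      using x that by (auto simp: space_PiM)
    have dist_sym: "(\<integral>\<^sup>+ y. ennreal \<bar>k j y - c y (x j)\<bar> \<partial>P) = (\<integral>\<^sup>+ y. ennreal \<bar>c y (x j) - k j y\<bar> \<partial>P)" for j k
      by (simp add: abs_minus_commute)
    show "plan_cost n P (\<lambda>j y. ennreal (c y (x j))) \<le> (INF k\<in>?K. ?approx k x)"
    proof (rule INF_greatest)
      fix k assume k: "k \<in> ?K"
      show "plan_cost n P (\<lambda>j y. ennreal (c y (x j))) \<le> ?approx k x"
        by (rule plan_cost_lipschitz) (use k H(2) sect x_j in \<open>auto simp: PiE_iff\<close>)
    qed
    show "(INF k\<in>?K. ?approx k x) \<le> plan_cost n P (\<lambda>j y. ennreal (c y (x j)))"
    proof (rule ennreal_le_epsilon)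
      fix e :: real assume e: "0 < e"
      \<comment> \<open>The error \<open>d\<close> occurs twice for each of the \<open>n\<close>
        atoms; the \<open>+ 1\<close> covers \<open>n = 0\<close>.\<close>
      define d where "d = e / (2 * real n + 1)"
      have d: "d > 0" "2 * (real n * d) \<le> e"
        using e by (auto simp: d_def field_simps)
      have "\<forall>j\<in>{1..n}. \<exists>h\<in>H. (\<integral>\<^sup>+ y. ennreal \<bar>c y (x j) - h y\<bar> \<partial>P) < ennreal d"
        using H(3) x_j d by auto
      then obtain h where h: "\<And>j. j \<in> {1..n} \<Longrightarrow> h j \<in> H \<and> (\<integral>\<^sup>+ y. ennreal \<bar>c y (x j) - h j y\<bar> \<partial>P) < ennreal d"
        by metis
      define k where "k = restrict h {1..n}"
      have k: "k \<in> ?K" "\<And>j. j \<in> {1..n} \<Longrightarrow> (\<integral>\<^sup>+ y. ennreal \<bar>c y (x j) - k j y\<bar> \<partial>P) < ennreal d"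
        using h by (auto simp: k_def)
      have dist: "?dist x k \<le> ennreal (real n * d)"
      proof -
        have "?dist x k \<le> (\<Sum>j = 1..n. ennreal d)"
          using k(2) by (intro sum_mono) (auto intro: less_imp_le)
        also have "\<dots> = ennreal (real n * d)"
          using d by (simp add: ennreal_mult ennreal_of_nat_eq_real_of_nat)
        finally show ?thesis .
      qed
      have "(INF k\<in>?K. ?approx k x) \<le> ?approx k x"
        using k(1) by (rule INF_lower)
      also have "plan_cost n P (\<lambda>j y. ennreal (k j y)) \<le> plan_cost n P (\<lambda>j y. ennreal (c y (x j))) + ?dist x k"
        unfolding dist_sym[symmetric]
        by (rule plan_cost_lipschitz) (use k(1) H(2) sect x_j in \<open>auto simp: PiE_iff\<close>)
      also have "plan_cost n P (\<lambda>j y. ennreal (c y (x j))) + ?dist x k + ?dist x k \<le>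
          plan_cost n P (\<lambda>j y. ennreal (c y (x j))) + ennreal (real n * d) + ennreal (real n * d)"
        by (intro add_mono dist order_refl)
      also have "\<dots> = plan_cost n P (\<lambda>j y. ennreal (c y (x j))) + ennreal (2 * (real n * d))"
        using d by (simp add: add.assoc flip: ennreal_plus)
      also have "\<dots> \<le> plan_cost n P (\<lambda>j y. ennreal (c y (x j))) + ennreal e"
        using d by (intro add_mono order_refl ennreal_leI)
      finally show "(INF k\<in>?K. ?approx k x) \<le> plan_cost n P (\<lambda>j y. ennreal (c y (x j))) + ennreal e"
        by (simp add: add_right_mono)
    qed
  qed
  have "(\<lambda>x. INF k\<in>?K. ?approx k x) \<in> borel_measurable ?\<Pi>"
  proof (rule borel_measurable_INF)
    show "countable ?K"
      using H(1) by (intro countable_PiE) auto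
    fix k assume k: "k \<in> ?K"
    \<comment> \<open>With \<open>k\<close> fixed this is an integral depending on a parameter,
      measurable as in Tonelli's theorem.\<close>
    have "(\<lambda>x. \<integral>\<^sup>+ y. ennreal \<bar>c y (x j) - k j y\<bar> \<partial>P) \<in> borel_measurable ?\<Pi>" if j: "j \<in> {1..n}" for j
    proof (rule measurable_compose[of "\<lambda>x. x j" _ S])
      have [measurable]: "k j \<in> borel_measurable P"
        using k j H(2) by auto
      note c[measurable]
      show "(\<lambda>z. \<integral>\<^sup>+ y. ennreal \<bar>c y z - k j y\<bar> \<partial>P) \<in> borel_measurable S"
        by measurable
    qed (use j in auto)
    then show "?approx k \<in> borel_measurable ?\<Pi>"
      by (intro borel_measurable_add borel_measurable_sum) auto
  qed
  then show ?thesis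
    by (subst measurable_cong[OF eq])
qed

subsection \<open>The triangle inequality\<close>

text \<open>Convexity of the power function at \<open>a / u\<close> and \<open>b / v\<close> with
  weights \<open>u = s / (s + t)\<close> and \<open>v = t / (s + t)\<close>. Equality holds for
  \<open>a = s\<close> and \<open>b = t\<close>, which is why the weights lose nothing in the
  triangle inequality.\<close>

lemma powr_add_le_weighted:
  fixes a b s t p :: real
  assumes "p \<ge> 1" "a \<ge> 0" "b \<ge> 0" "s > 0" "t > 0"
  shows "(a + b) powr p \<le> (s / (s + t)) powr (1 - p) * a powr p + (t / (s + t)) powr (1 - p) * b powr p"
proof -
  define u v where "u = s / (s + t)" and "v = t / (s + t)"
  have uv: "0 < u" "0 < v" "u \<le> 1" "v \<le> 1" and eq: "1 - v = u"
    using assms by (auto simp: u_def v_def field_simps)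
  have ge1: "w powr (1 - p) \<ge> 1" if "0 < w" "w \<le> 1" for w :: real
    using powr_mono'[of "1 - p" 0 w] that assms by simp
  \<comment> \<open>If a summand vanishes, it is enough that the factor of the other one is at least
    1.\<close>
  consider "a = 0" | "b = 0" | "a > 0" "b > 0" using assms by linarith
  then have "(a + b) powr p \<le> u powr (1 - p) * a powr p + v powr (1 - p) * b powr p"
  proof cases
    case 1
    then show ?thesis
      using mult_right_mono[OF ge1[OF uv(2,4)], of "b powr p"] by simp
  next
    case 2
    then show ?thesis
      using mult_right_mono[OF ge1[OF uv(1,3)], of "a powr p"] by simp
  next
    case 3
    have scale: "w * (z / w) powr p = w powr (1 - p) * z powr p" if "w > 0" "z > 0" for w z :: real
      using that by (simp add: powr_divide powr_diff)
    have "(u * (a / u) + v * (b / v)) powr p \<le> u * (a / u) powr p + v * (b / v) powr p"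
      using convex_onD[OF powr_convex[OF assms(1)], of v "a / u" "b / v"] 3 uv
      by (simp add: eq)
    then show ?thesis
      using 3 uv by (simp add: scale)
  qed
  then show ?thesis by (simp add: u_def v_def)
qed

text \<open>Gluing: the coupling \<open>\<gamma>\<close> of \<open>R\<close> and \<open>P\<close> is split by the densities \<open>f j\<close> of a plan from \<open>R\<close> to the
  atoms. The weighted convexity inequality with weights \<open>s / (s + t)\<close> and \<open>t / (s + t)\<close> replaces
  Minkowski's inequality.\<close>

lemma (in uniform_on_points) transport_cost_triangle:
  fixes \<delta> :: "'a \<Rightarrow> 'a \<Rightarrow> real"
  assumes P: "sets P = sets E" and R: "prob_space R" "sets R = sets E"
    and \<delta>: "Metric_space (space E) \<delta>" "case_prod \<delta> \<in> borel_measurable (E \<Otimes>\<^sub>M E)"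
    and p: "p \<ge> 1" and st: "s > 0" "t > 0"
    and RP: "transport_cost (\<lambda>y z. ennreal (\<delta> y z powr p)) R P < ennreal (s powr p)"
    and RE: "transport_cost (\<lambda>y z. ennreal (\<delta> y z powr p)) R E < ennreal (t powr p)"
  shows "transport_cost (\<lambda>y z. ennreal (\<delta> y z powr p)) P E \<le> ennreal ((s + t) powr p)"
proof -
  interpret Metric_space "space E" \<delta> by fact
  let ?c = "\<lambda>y z. ennreal (\<delta> y z powr p)"
  let ?u = "(s / (s + t)) powr (1 - p)" and ?v = "(t / (s + t)) powr (1 - p)"
  have c: "case_prod ?c \<in> borel_measurable (E \<Otimes>\<^sub>M E)"
    using \<delta>(2) by (auto simp: case_prod_unfold)
  obtain \<gamma> where \<gamma>: "\<gamma> \<in> couplings R P" and \<gamma>_cost: "(\<integral>\<^sup>+ (y, z). ?c y z \<partial>\<gamma>) < ennreal (s powr p)"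
    using RP unfolding transport_cost_def INF_less_iff by blast
  obtain \<eta> where \<eta>: "\<eta> \<in> couplings R E" and \<eta>_cost: "(\<integral>\<^sup>+ (y, z). ?c y z \<partial>\<eta>) < ennreal (t powr p)"
    using RE unfolding transport_cost_def INF_less_iff by blast
  obtain f where f: "f \<in> transport_plans n R"
    and "\<And>c. case_prod c \<in> borel_measurable (E \<Otimes>\<^sub>M E) \<Longrightarrow>
      (\<Sum>j = 1..n. \<integral>\<^sup>+ y. f j y * c y (x j) \<partial>R) = (\<integral>\<^sup>+ (y, z). c y z \<partial>\<eta>)"
    using \<eta> by (rule coupling_plan[OF R]) blast
  from this(2)[OF c] have f_cost: "(\<Sum>j = 1..n. \<integral>\<^sup>+ y. f j y * ?c y (x j) \<partial>R) = (\<integral>\<^sup>+ (y, z). ?c y z \<partial>\<eta>)" .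
  have fst: "fst \<in> measurable \<gamma> R" and snd: "snd \<in> measurable \<gamma> P"
    and distr_fst: "distr \<gamma> R fst = R" and distr_snd: "distr \<gamma> P snd = P"
    using couplingsD[OF \<gamma>] by auto
  have sets_\<gamma>: "sets \<gamma> = sets (E \<Otimes>\<^sub>M E)"
    using couplingsD(1)[OF \<gamma>] P R(2) by (simp cong: sets_pair_measure_cong)
  have prob_\<gamma>: "prob_space \<gamma>"
    using fst R(1) distr_fst by (metis prob_space_distrD)
  have space_\<gamma>: "space \<gamma> = space E \<times> space E"
    using sets_eq_imp_space_eq[OF sets_\<gamma>] by (simp add: space_pair_measure)
  have integral_fst: "(\<integral>\<^sup>+ v. h (fst v) \<partial>\<gamma>) = (\<integral>\<^sup>+ y. h y \<partial>R)" if "h \<in> borel_measurable R" for h :: "'a \<Rightarrow> ennreal"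
    using nn_integral_distr[OF fst, of h] that distr_fst by simp
  \<comment> \<open>The plan for \<open>R\<close> is lifted to \<open>\<gamma>\<close>, where it
    becomes a plan from \<open>\<gamma>\<close> to the atoms; mapping by \<open>snd\<close> then
    transports \<open>P\<close>.\<close>
  define g where "g j v = f j (fst v)" for j and v :: "'a \<times> 'a"
  have g: "g \<in> transport_plans n \<gamma>"
    unfolding transport_plans_def
  proof (intro CollectI conjI ballI)
    fix j assume j: "j \<in> {1..n}"
    show "g j \<in> borel_measurable \<gamma>"
      unfolding g_def by (rule measurable_compose[OF fst transport_plans_measurable[OF f j]])
    show "(\<integral>\<^sup>+ v. g j v \<partial>\<gamma>) = 1 / of_nat n"
      unfolding g_def integral_fst[OF transport_plans_measurable[OF f j]]
      by (rule transport_plans_integral[OF f j])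
  next
    have "AE y in distr \<gamma> R fst. (\<Sum>j = 1..n. f j y) = 1"
      using transport_plans_sum[OF f] by (subst distr_fst)
    then show "AE v in \<gamma>. (\<Sum>j = 1..n. g j v) = 1"
      unfolding g_def by (rule AE_distrD[OF fst])
  qed
  have c_\<gamma>: "(\<lambda>v. ?c (fst v) (snd v)) \<in> borel_measurable \<gamma>"
    using c by (simp add: case_prod_unfold measurable_cong_sets[OF sets_\<gamma> refl])
  have c_x: "(\<lambda>y. ?c y (x j)) \<in> borel_measurable R" if "j \<in> {1..n}" for j
    using measurable_compose[OF measurable_Pair2'[OF x[OF that], of E] c]
    by (simp add: measurable_cong_sets[OF R(2) refl])
  have c_x_\<gamma>: "(\<lambda>v. ?c (fst v) (x j)) \<in> borel_measurable \<gamma>" if "j \<in> {1..n}" for j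
    by (rule measurable_compose[OF fst c_x[OF that]])
  have "transport_cost ?c P E \<le> (\<Sum>j = 1..n. \<integral>\<^sup>+ v. g j v * ?c (snd v) (x j) \<partial>\<gamma>)"
    by (rule transport_cost_le_plan[OF prob_\<gamma> snd distr_snd P g c])
  also have "\<dots> \<le> (\<Sum>j = 1..n. ennreal ?u * (\<integral>\<^sup>+ v. g j v * ?c (fst v) (snd v) \<partial>\<gamma>) +
      ennreal ?v * (\<integral>\<^sup>+ v. g j v * ?c (fst v) (x j) \<partial>\<gamma>))"
  proof (rule sum_mono)
    fix j assume j: "j \<in> {1..n}"
    note [measurable] = transport_plans_measurable[OF g j] c_\<gamma> c_x_\<gamma>[OF j]
    have "(\<integral>\<^sup>+ v. g j v * ?c (snd v) (x j) \<partial>\<gamma>) \<le>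
        (\<integral>\<^sup>+ v. ennreal ?u * (g j v * ?c (fst v) (snd v)) + ennreal ?v * (g j v * ?c (fst v) (x j)) \<partial>\<gamma>)"
    proof (rule nn_integral_mono)
      fix v assume "v \<in> space \<gamma>"
      then have v: "fst v \<in> space E" "snd v \<in> space E" by (auto simp: space_\<gamma>)
      have "\<delta> (snd v) (x j) \<le> \<delta> (fst v) (snd v) + \<delta> (fst v) (x j)"
        using triangle[OF v(2,1) x[OF j]] by (simp add: commute)
      then have "\<delta> (snd v) (x j) powr p \<le> (\<delta> (fst v) (snd v) + \<delta> (fst v) (x j)) powr p"
        using p by (intro powr_mono2) auto
      also have "\<dots> \<le> ?u * \<delta> (fst v) (snd v) powr p + ?v * \<delta> (fst v) (x j) powr p"
        using p st by (intro powr_add_le_weighted) auto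
      finally have "g j v * ?c (snd v) (x j) \<le>
          g j v * ennreal (?u * \<delta> (fst v) (snd v) powr p + ?v * \<delta> (fst v) (x j) powr p)"
        by (intro mult_left_mono ennreal_leI) auto
      also have "\<dots> = ennreal ?u * (g j v * ?c (fst v) (snd v)) + ennreal ?v * (g j v * ?c (fst v) (x j))"
        by (simp add: ennreal_mult distrib_left mult_ac)
      finally show "g j v * ?c (snd v) (x j) \<le> \<dots>" .
    qed
    also have "\<dots> = ennreal ?u * (\<integral>\<^sup>+ v. g j v * ?c (fst v) (snd v) \<partial>\<gamma>) +
        ennreal ?v * (\<integral>\<^sup>+ v. g j v * ?c (fst v) (x j) \<partial>\<gamma>)"
      by (subst nn_integral_add) (auto simp: nn_integral_cmult)
    finally show "(\<integral>\<^sup>+ v. g j v * ?c (snd v) (x j) \<partial>\<gamma>) \<le> \<dots>" .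
  qed
  also have "\<dots> = ennreal ?u * (\<Sum>j = 1..n. \<integral>\<^sup>+ v. g j v * ?c (fst v) (snd v) \<partial>\<gamma>) +
      ennreal ?v * (\<Sum>j = 1..n. \<integral>\<^sup>+ v. g j v * ?c (fst v) (x j) \<partial>\<gamma>)"
    by (simp add: sum.distrib sum_distrib_left)
  \<comment> \<open>The first cost ignores the atom, so the pieces recombine to the cost of
    \<open>\<gamma>\<close>; the second ignores \<open>snd v\<close>, so it is an integral over
    \<open>R\<close> and gives the cost of \<open>\<eta>\<close>.\<close>
  also have "(\<Sum>j = 1..n. \<integral>\<^sup>+ v. g j v * ?c (fst v) (snd v) \<partial>\<gamma>) = (\<integral>\<^sup>+ (y, z). ?c y z \<partial>\<gamma>)"
    using nn_integral_transport_plans_mult[OF g c_\<gamma>] by (simp add: case_prod_unfold)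
  also have "(\<Sum>j = 1..n. \<integral>\<^sup>+ v. g j v * ?c (fst v) (x j) \<partial>\<gamma>) = (\<integral>\<^sup>+ (y, z). ?c y z \<partial>\<eta>)"
    unfolding f_cost[symmetric]
  proof (rule sum.cong[OF refl])
    fix j assume j: "j \<in> {1..n}"
    note [measurable] = transport_plans_measurable[OF f j] c_x[OF j]
    show "(\<integral>\<^sup>+ v. g j v * ?c (fst v) (x j) \<partial>\<gamma>) = (\<integral>\<^sup>+ y. f j y * ?c y (x j) \<partial>R)"
      unfolding g_def by (rule integral_fst) measurable
  qed
  also have "ennreal ?u * (\<integral>\<^sup>+ (y, z). ?c y z \<partial>\<gamma>) + ennreal ?v * (\<integral>\<^sup>+ (y, z). ?c y z \<partial>\<eta>) \<le>
      ennreal ?u * ennreal (s powr p) + ennreal ?v * ennreal (t powr p)"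
    using \<gamma>_cost \<eta>_cost by (intro add_mono mult_left_mono) auto
  also have "\<dots> = ennreal (?u * s powr p + ?v * t powr p)"
    by (simp add: ennreal_mult)
  also have "?u * s powr p + ?v * t powr p = (s + t) powr p"
  proof -
    have *: "(w / (s + t)) powr (1 - p) * w powr p = w * ((s + t) powr p / (s + t))" if "w > 0" for w
      using that st by (simp add: powr_divide powr_diff)
    show ?thesis
      using st by (simp add: * flip: add_divide_distrib distrib_right)
  qed
  finally show ?thesis .
qed

section \<open>The Wasserstein distance and its balls\<close>

text \<open>Disposes of the root and of the separate value for infinite cost, so that balls become
  sublevel sets of the transport cost.\<close>

lemma wasserstein_le_iff:
  assumes "p > 0" "e \<ge> 0"
  shows "wasserstein \<delta> p P Q \<le> ereal e \<longleftrightarrow>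
    transport_cost (\<lambda>y z. ennreal (\<delta> y z powr p)) P Q \<le> ennreal (e powr p)"
proof (cases "transport_cost (\<lambda>y z. ennreal (\<delta> y z powr p)) P Q")
  case (real q)
  have "wasserstein \<delta> p P Q = ereal (q powr (1 / p))"
    using real by (simp add: wasserstein_def transport_cost_def)
  moreover have "q powr (1 / p) \<le> e \<longleftrightarrow> q \<le> e powr p"
  proof
    assume "q powr (1 / p) \<le> e"
    then have "(q powr (1 / p)) powr p \<le> e powr p"
      using assms by (intro powr_mono2) auto
    then show "q \<le> e powr p" using assms real by (simp add: powr_powr)
  next
    assume "q \<le> e powr p"
    then have "q powr (1 / p) \<le> (e powr p) powr (1 / p)"
      using assms real by (intro powr_mono2) auto
    then show "q powr (1 / p) \<le> e" using assms by (simp add: powr_powr)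
  qed
  ultimately show ?thesis using real by simp
next
  case top
  then show ?thesis by (simp add: wasserstein_def transport_cost_def top_unique)
qed

lemma wasserstein_nonneg: "0 \<le> wasserstein \<delta> p P Q"
  by (simp add: wasserstein_def Let_def)

lemma (in uniform_on_points) wasserstein_triangle:
  assumes "sets P = sets E" "prob_space R" "sets R = sets E"
    and "Metric_space (space E) \<delta>" "case_prod \<delta> \<in> borel_measurable (E \<Otimes>\<^sub>M E)"
    and p: "p \<ge> 1" and RP: "wasserstein \<delta> p R P \<le> ereal a" and RE: "wasserstein \<delta> p R E \<le> ereal b"
  shows "wasserstein \<delta> p P E \<le> ereal (a + b)"
proof (rule ereal_le_epsilon2)
  have nonneg: "a \<ge> 0" "b \<ge> 0"
    using RP RE wasserstein_nonneg by (metis ereal_less_eq(5) order_trans)+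
  fix e :: real assume e: "0 < e"
  show "wasserstein \<delta> p P E \<le> ereal (a + b) + ereal e"
  proof -
    have less: "ennreal (w powr p) < ennreal ((w + e / 2) powr p)" if "w \<ge> 0" for w
      using that p e by (intro ennreal_lessI powr_less_mono2) auto
    have "transport_cost (\<lambda>y z. ennreal (\<delta> y z powr p)) P E \<le> ennreal (((a + e / 2) + (b + e / 2)) powr p)"
      using RP RE nonneg p e
      by (intro transport_cost_triangle[OF assms(1-6)] le_less_trans[OF _ less]) (auto simp: wasserstein_le_iff)
    then have "transport_cost (\<lambda>y z. ennreal (\<delta> y z powr p)) P E \<le> ennreal ((a + b + e) powr p)"
      by (simp add: add_ac)
    then show ?thesis
      using nonneg p e by (simp add: wasserstein_le_iff[symmetric])
  qed
qed

text \<open>For a negative radius the event is empty. Otherwise it is a sublevel set of the plan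
  cost, which is measurable if all sections of the cost are integrable and constantly infinite if
  one is not. \<open>S\<close> is separate from \<open>P\<close> since the samples follow another
  distribution.\<close>

lemma wasserstein_ball_empirical_measurable:
  fixes \<Xi> :: "'a::t1_space set"
  assumes metric: "Metric_space \<Xi> \<delta>"
    and meas: "case_prod \<delta> \<in> borel_measurable (restrict_space borel \<Xi> \<Otimes>\<^sub>M restrict_space borel \<Xi>)"
    and p: "p \<ge> 1" and P: "P \<in> distributions_on \<Xi>" and n: "n \<ge> 1"
    and S: "sets S = sets (restrict_space borel \<Xi>)"
  shows "{x \<in> space (\<Pi>\<^sub>M j\<in>{1..n}. S). P \<in> wasserstein_ball \<Xi> \<delta> p e (empirical \<Xi> n x)} \<in> sets (\<Pi>\<^sub>M j\<in>{1..n}. S)"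
proof -
  interpret Metric_space \<Xi> \<delta> by fact
  let ?\<Pi> = "\<Pi>\<^sub>M j\<in>{1..n}. S"
  let ?cost = "\<lambda>x. plan_cost n P (\<lambda>j y. ennreal (\<delta> y (x j) powr p))"
  have sets_P: "sets P = sets (restrict_space borel \<Xi>)" and prob_P: "prob_space P"
    using P by (auto simp: distributions_on_def)
  have space_S: "space S = \<Xi>" and space_P: "space P = \<Xi>"
    using sets_eq_imp_space_eq[OF S] sets_eq_imp_space_eq[OF sets_P] by (auto simp: space_restrict_space)
  have c: "case_prod (\<lambda>y z. \<delta> y z powr p) \<in> borel_measurable (P \<Otimes>\<^sub>M S)"
    using meas by (simp add: case_prod_unfold measurable_cong_sets[OF sets_pair_measure_cong[OF sets_P S] refl])
  have sect: "(\<lambda>y. \<delta> y z powr p) \<in> borel_measurable P" if "z \<in> \<Xi>" for z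
    using measurable_compose[OF measurable_Pair2'[of z S P] c] that by (simp add: space_S)
  have x_j: "x j \<in> \<Xi>" if "x \<in> space ?\<Pi>" "j \<in> {1..n}" for x j
    using that by (auto simp: space_PiM space_S)
  show ?thesis
  proof (cases "e \<ge> 0")
    case False
    have "\<not> wasserstein \<delta> p P Q \<le> ereal e" for Q
      using False order_trans[OF wasserstein_nonneg, of \<delta> p P Q "ereal e"] by auto
    then show ?thesis by (simp add: wasserstein_ball_def)
  next
    case True
    have ball: "P \<in> wasserstein_ball \<Xi> \<delta> p e (empirical \<Xi> n x) \<longleftrightarrow> ?cost x \<le> ennreal (e powr p)"
      if x: "x \<in> space ?\<Pi>" for x
    proof -
      interpret uniform_on_points "empirical \<Xi> n x" n x
        by (rule uniform_on_points_empirical[OF n x_j[OF x]])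
      have "(\<lambda>(y, z). ennreal (\<delta> y z powr p)) \<in> borel_measurable (empirical \<Xi> n x \<Otimes>\<^sub>M empirical \<Xi> n x)"
        using meas by (simp add: case_prod_unfold
            measurable_cong_sets[OF sets_pair_measure_cong[OF sets_empirical sets_empirical] refl])
      from transport_cost_eq_plan_cost[OF prob_P _ this] True p P show ?thesis
        by (simp add: wasserstein_ball_def wasserstein_le_iff sets_P sets_empirical)
    qed
    have "?cost \<in> borel_measurable ?\<Pi>"
    proof (cases "\<forall>z\<in>\<Xi>. (\<integral>\<^sup>+ y. ennreal (\<delta> y z powr p) \<partial>P) < \<top>")
      case True
      interpret P: prob_space P by fact
      show ?thesis
        using True by (intro measurable_plan_cost P.finite_measure_axioms c) (auto simp: space_S)
    next
      case False
      then obtain z where z: "z \<in> \<Xi>" "(\<integral>\<^sup>+ y. ennreal (\<delta> y z powr p) \<partial>P) = \<infinity>"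
        by (auto simp: not_less top_unique)
      have "?cost x = \<infinity>" if x: "x \<in> space ?\<Pi>" for x
      proof (rule plan_cost_eq_top[where c = "\<lambda>y z. \<delta> y z powr p", OF prob_P _ _ sect[OF z(1)] z(2)])
        \<comment> \<open>The factor of the weighted inequality for \<open>s = t = 1\<close>, that
          is \<open>2 powr (p - 1)\<close>. Summing over all atoms makes \<open>D\<close>
          independent of \<open>j\<close>.\<close>
        define C where "C = (1 / (1 + 1)) powr (1 - p)"
        define D where "D = (\<Sum>j = 1..n. C * \<delta> (x j) z powr p)"
        have C: "C \<ge> 0" by (simp add: C_def)
        then show "0 \<le> C" "0 \<le> D" by (auto simp: D_def intro!: sum_nonneg)
        fix j y assume j: "j \<in> {1..n}" and y: "y \<in> space P"
        have "\<delta> y z powr p \<le> (\<delta> y (x j) + \<delta> (x j) z) powr p"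
          using p triangle y x_j[OF x j] z(1) by (intro powr_mono2) (auto simp: space_P)
        also have "\<dots> \<le> C * \<delta> y (x j) powr p + C * \<delta> (x j) z powr p"
          unfolding C_def using p by (intro powr_add_le_weighted) auto
        also have "C * \<delta> (x j) z powr p \<le> D"
          unfolding D_def using C j by (intro member_le_sum) auto
        finally show "\<delta> y z powr p \<le> C * \<delta> y (x j) powr p + D" by simp
      qed (use sect x_j[OF x] in auto)
      then show ?thesis by (subst measurable_cong) auto
    qed
    then have "{x \<in> space ?\<Pi>. ?cost x \<le> ennreal (e powr p)} \<in> sets ?\<Pi>"
      by measurable
    also have "{x \<in> space ?\<Pi>. ?cost x \<le> ennreal (e powr p)} =
        {x \<in> space ?\<Pi>. P \<in> wasserstein_ball \<Xi> \<delta> p e (empirical \<Xi> n x)}"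
      using ball by auto
    finally show ?thesis .
  qed
qed

subsection \<open>Confidence levels\<close>

lemma confidence_radius_nonneg: "0 \<le> confidence_radius d p a c\<^sub>1 c\<^sub>2 \<beta> n"
  by (simp add: confidence_radius_def)

text \<open>The radius solves the equation for the level, the exponents of the two being reciprocal.
  If \<open>c\<^sub>1 \<le> \<beta>\<close>, the logarithm is not positive and there is nothing to
  solve, but the level never exceeds \<open>c\<^sub>1\<close>; hence an inequality.\<close>

lemma confidence_level_radius:
  assumes "d > 0" "p \<ge> 1" "a > 0" "c\<^sub>1 > 0" "c\<^sub>2 > 0" "\<beta> > 0" "n \<ge> 1"
  shows "confidence_level d p a c\<^sub>1 c\<^sub>2 (confidence_radius d p a c\<^sub>1 c\<^sub>2 \<beta> n) n \<le> \<beta>"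
proof (cases "c\<^sub>1 \<le> \<beta>")
  case True
  have "c\<^sub>1 * exp (- c\<^sub>2 * real n * w) \<le> \<beta>" if "w \<ge> 0" for w
  proof -
    have "c\<^sub>1 * exp (- c\<^sub>2 * real n * w) \<le> c\<^sub>1 * 1"
      using assms that by (intro mult_left_mono) auto
    with True show ?thesis by simp
  qed
  then show ?thesis by (simp add: confidence_level_def)
next
  case False
  define L where "L = ln (c\<^sub>1 / \<beta>)"
  define q where "q = L / (c\<^sub>2 * real n)"
  have L: "L > 0" "c\<^sub>1 * exp (- L) = \<beta>"
    using False assms by (auto simp: L_def exp_minus field_simps)
  have q: "q > 0" "c\<^sub>2 * real n * q = L"
    using L assms by (auto simp: q_def)
  show ?thesis
  \<comment> \<open>The condition says \<open>q \<le> 1\<close>, which is equivalent to a radius of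
    at most 1, so both definitions switch regime together.\<close>
  proof (cases "real n \<ge> L / c\<^sub>2")
    case True
    then have r: "confidence_radius d p a c\<^sub>1 c\<^sub>2 \<beta> n = q powr min (p / d) (1 / 2)"
      by (simp add: confidence_radius_def L_def q_def)
    have "q \<le> 1" using True assms by (simp add: q_def field_simps)
    then have "q powr min (p / d) (1 / 2) \<le> 1"
      using q assms by (intro powr_le1) auto
    moreover have "min (p / d) (1 / 2) * max (d / p) 2 = 1"
      using assms by (auto simp: min_def max_def field_simps)
    ultimately show ?thesis
      using q L by (simp add: r confidence_level_def powr_powr)
  next
    case False
    then have r: "confidence_radius d p a c\<^sub>1 c\<^sub>2 \<beta> n = q powr (p / a)"
      by (simp add: confidence_radius_def L_def q_def)
    have "q > 1" using False assms by (simp add: q_def field_simps)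
    then have "q powr (p / a) > 1"
      using assms by (intro gr_one_powr) auto
    then show ?thesis
      using q L assms by (simp add: r confidence_level_def powr_powr)
  qed
qed

text \<open>Independence gives a product, bounded below by the Weierstrass product inequality. That
  \<open>\<beta> i \<le> 1\<close> keeps the factors \<open>1 - \<beta> i\<close>
  nonnegative.\<close>

lemma prob_PiM_ge_1_minus_sum:
  assumes "finite I" and M: "\<And>i. i \<in> I \<Longrightarrow> prob_space (M i)"
    and A: "\<And>i. i \<in> I \<Longrightarrow> A i \<in> sets (M i)"
    and \<beta>: "\<And>i. i \<in> I \<Longrightarrow> measure (M i) (A i) \<ge> 1 - \<beta> i" "\<And>i. i \<in> I \<Longrightarrow> \<beta> i \<in> {0..1}"
  shows "measure (PiM I M) (Pi\<^sub>E I A) \<ge> 1 - sum \<beta> I"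
proof -
  have "prod_emb I M I (Pi\<^sub>E I A) = Pi\<^sub>E I A"
    using sets.sets_into_space[OF A] by (rule prod_emb_PiE_same_index)
  moreover have "emeasure (PiM I M) (prod_emb I M I (Pi\<^sub>E I A)) = (\<Prod>i\<in>I. emeasure (M i) (A i))"
    by (rule emeasure_PiM_emb) (use M A \<open>finite I\<close> in auto)
  ultimately have "emeasure (PiM I M) (Pi\<^sub>E I A) = (\<Prod>i\<in>I. emeasure (M i) (A i))"
    by simp
  also have "\<dots> = (\<Prod>i\<in>I. ennreal (measure (M i) (A i)))"
    using M by (intro prod.cong refl finite_measure.emeasure_eq_measure) (auto simp: prob_space_def)
  also have "\<dots> = ennreal (\<Prod>i\<in>I. measure (M i) (A i))"
    by (rule prod_ennreal) simp
  finally have "measure (PiM I M) (Pi\<^sub>E I A) = (\<Prod>i\<in>I. measure (M i) (A i))"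
    by (simp add: measure_def prod_nonneg)
  moreover have "(\<Prod>i\<in>I. 1 - \<beta> i) \<le> (\<Prod>i\<in>I. measure (M i) (A i))"
    using \<beta> by (intro prod_mono) auto
  moreover have "1 - sum \<beta> I \<le> (\<Prod>i\<in>I. 1 - \<beta> i)"
    using \<beta>(2) by (rule Weierstrass_prod_ineq)
  ultimately show ?thesis by simp
qed

section \<open>The joint confidence bound\<close>

theorem proposition3:
  fixes \<Xi> :: "(real ^ 'd) set" and \<delta> :: "real ^ 'd \<Rightarrow> real ^ 'd \<Rightarrow> real"
    and K :: nat and N :: "nat \<Rightarrow> nat"
    and Pk :: "nat \<Rightarrow> (real ^ 'd) measure" and P :: "(real ^ 'd) measure"
    and p a A c\<^sub>1 c\<^sub>2 :: real and r \<epsilon> \<beta> :: "nat \<Rightarrow> real"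
  assumes "closed \<Xi>" and "convex \<Xi>"
    and "Metric_space \<Xi> \<delta>"
    and "(\<lambda>(x, y). \<delta> x y)
           \<in> borel_measurable (restrict_space borel \<Xi> \<Otimes>\<^sub>M restrict_space borel \<Xi>)"
    and "p \<ge> 1" and "p \<noteq> real CARD('d) / 2" and "a > p" and "A > 0"
    and "\<And>k. k \<in> {1..K} \<Longrightarrow> N k \<ge> 1"
    and "\<And>k. k \<in> {1..K} \<Longrightarrow> Pk k \<in> distributions_on \<Xi>"
    and "\<And>k. k \<in> {1..K} \<Longrightarrow> light_tailed a A (Pk k)"
    and "c\<^sub>1 > 0" and "c\<^sub>2 > 0"
    and concentration: "\<And>k n e. k \<in> {1..K} \<Longrightarrow> n \<ge> 1 \<Longrightarrow> e \<ge> 0 \<Longrightarrow>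
           \<P>(x in (\<Pi>\<^sub>M j\<in>{1..n}. Pk k). Pk k \<in> wasserstein_ball \<Xi> \<delta> p e (empirical \<Xi> n x))
             \<ge> 1 - confidence_level (real CARD('d)) p a c\<^sub>1 c\<^sub>2 e n"
    and "P \<in> distributions_on \<Xi>"
    and "\<And>k. k \<in> {1..K} \<Longrightarrow> wasserstein \<delta> p (Pk k) P \<le> ereal (r k)"
    and "\<And>k. k \<in> {1..K} \<Longrightarrow> 0 < \<beta> k \<and> \<beta> k \<le> 1"
    and "\<And>k. k \<in> {1..K} \<Longrightarrow>
           \<epsilon> k \<ge> r k + confidence_radius (real CARD('d)) p a c\<^sub>1 c\<^sub>2 (\<beta> k) (N k)"
  shows "\<P>(\<omega> in (\<Pi>\<^sub>M k\<in>{1..K}. \<Pi>\<^sub>M j\<in>{1..N k}. Pk k).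
           P \<in> (\<Inter>k\<in>{1..K}. wasserstein_ball \<Xi> \<delta> p (\<epsilon> k) (empirical \<Xi> (N k) (\<omega> k))))
         \<ge> 1 - (\<Sum>k = 1..K. \<beta> k)"
proof -
  let ?M = "\<lambda>k. \<Pi>\<^sub>M j\<in>{1..N k}. Pk k"
  let ?rad = "\<lambda>k. confidence_radius (real CARD('d)) p a c\<^sub>1 c\<^sub>2 (\<beta> k) (N k)"
  define F where "F k = {x \<in> space (?M k). P \<in> wasserstein_ball \<Xi> \<delta> p (\<epsilon> k) (empirical \<Xi> (N k) x)}" for k
  note metric = assms(3) and meas = assms(4) and p = assms(5)
  have Pk: "sets (Pk k) = sets (restrict_space borel \<Xi>)" "prob_space (Pk k)" "space (Pk k) = \<Xi>" if "k \<in> {1..K}" for k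
    using assms(10)[OF that] sets_eq_imp_space_eq[of "Pk k" "restrict_space borel \<Xi>"]
    by (auto simp: distributions_on_def space_restrict_space)
  have prob_M: "prob_space (?M k)" if "k \<in> {1..K}" for k
    using Pk(2)[OF that] by (intro prob_space_PiM)
  \<comment> \<open>Measurability of the larger event is what monotonicity of the measure along
    \<open>?E \<subseteq> F k\<close> requires, and the product formula as well.\<close>
  have F_sets: "F k \<in> sets (?M k)" if k: "k \<in> {1..K}" for k
    unfolding F_def
    by (rule wasserstein_ball_empirical_measurable[OF metric meas p assms(15) assms(9)[OF k] Pk(1)[OF k]])
  have F_prob: "measure (?M k) (F k) \<ge> 1 - \<beta> k" if k: "k \<in> {1..K}" for k
  proof -
    interpret M: prob_space "?M k" by (rule prob_M[OF k])
    let ?E = "{x \<in> space (?M k). Pk k \<in> wasserstein_ball \<Xi> \<delta> p (?rad k) (empirical \<Xi> (N k) x)}"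
    have "?E \<subseteq> F k"
    proof
      fix x assume "x \<in> ?E"
      then have x_M: "x \<in> space (?M k)" and W: "wasserstein \<delta> p (Pk k) (empirical \<Xi> (N k) x) \<le> ereal (?rad k)"
        by (auto simp: wasserstein_ball_def)
      interpret uniform_on_points "empirical \<Xi> (N k) x" "N k" x
        by (rule uniform_on_points_empirical[OF assms(9)[OF k]]) (use x_M Pk(3)[OF k] in \<open>auto simp: space_PiM\<close>)
      \<comment> \<open>\<open>Pk k\<close> is the intermediate distribution, within
        \<open>r k\<close> of \<open>P\<close> and within \<open>?rad k\<close> of the empirical
        one.\<close>
      have "wasserstein \<delta> p P (empirical \<Xi> (N k) x) \<le> ereal (r k + ?rad k)"
        using assms(15) Pk[OF k] metric meas p assms(16)[OF k] W
        by (intro wasserstein_triangle)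
          (auto simp: distributions_on_def sets_empirical space_empirical
            measurable_cong_sets[OF sets_pair_measure_cong[OF sets_empirical sets_empirical] refl])
      also have "\<dots> \<le> ereal (\<epsilon> k)"
        using assms(18)[OF k] by simp
      finally show "x \<in> F k"
        unfolding F_def wasserstein_ball_def using x_M assms(15) by blast
    qed
    have "1 - \<beta> k \<le> 1 - confidence_level (real CARD('d)) p a c\<^sub>1 c\<^sub>2 (?rad k) (N k)"
      using confidence_level_radius[of "real CARD('d)" p a c\<^sub>1 c\<^sub>2 "\<beta> k" "N k"] assms(5,7,9,12,13) assms(17)[OF k] k
      by simp
    also have "\<dots> \<le> measure (?M k) ?E"
      by (rule concentration[OF k assms(9)[OF k] confidence_radius_nonneg])
    also have "\<dots> \<le> measure (?M k) (F k)"
      using \<open>?E \<subseteq> F k\<close> F_sets[OF k] by (rule M.finite_measure_mono)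
    finally show ?thesis .
  qed
  have "1 - (\<Sum>k = 1..K. \<beta> k) \<le> measure (\<Pi>\<^sub>M k\<in>{1..K}. ?M k) (\<Pi>\<^sub>E k\<in>{1..K}. F k)"
  proof (rule prob_PiM_ge_1_minus_sum)
    show "\<beta> k \<in> {0..1}" if "k \<in> {1..K}" for k
      using assms(17)[OF that] by auto
  qed (use prob_M F_sets F_prob in auto)
  \<comment> \<open>Each ball constrains a single component of \<open>\<omega>\<close>, so the joint
    event is a box.\<close>
  also have "(\<Pi>\<^sub>E k\<in>{1..K}. F k) = {\<omega> \<in> space (\<Pi>\<^sub>M k\<in>{1..K}. ?M k).
      P \<in> (\<Inter>k\<in>{1..K}. wasserstein_ball \<Xi> \<delta> p (\<epsilon> k) (empirical \<Xi> (N k) (\<omega> k)))}"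
    by (auto simp: F_def space_PiM PiE_iff extensional_def)
  finally show ?thesis .
qed

end
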